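(* Assume A1–A5 (stated in the context). Let $f_n=\sum_{j=1}^\infty\theta_{nj}\phi_j$ be a sequence of alternatives with $cn^{-r}\le\|f_n\|\le Cn^{-r}$ for all $n$, where $0<c<C<\infty$. Then the sequence $f_n$ is consistent (for the test statistics $T_n$) if and only if there are $c_1>0$, $c_2>0$ and $n_0$ such that $$\sum_{j<c_2k_n}\theta_{nj}^2>c_1n^{-2r}\qquad\text{for all } n>n_0 .$$
   Context: Setting. Fix $0<r<1/2$ and $\sigma>0$. One observes $dY_n(t)=f(t)\,dt+\frac{\sigma}{\sqrt n}\,dw(t)$, $t\in[0,1]$, with unknown signal $f\in L_2(0,1)$ and Gaussian white noise $dw$. Let $(\phi_j)_{j\ge1}$ be an orthonormal basis of $L_2(0,1)$; then $y_j=\int_0^1\phi_j\,dY_n=\theta_j+\frac{\sigma}{\sqrt n}\xi_j$ with $\theta_j=\int_0^1f\phi_j\,dt$ and $\xi_j$ i.i.d. standard Gaussian. The hypothesis is $f=0$; alternatives are $f=f_n$. The test statistics are $$T_n=\sum_{j=1}^\infty\kappa_{nj}^2y_j^2-\sigma^2n^{-1}\rho_n,\qquad \rho_n=\sum_{j=1}^\infty\kappa_{nj}^2 .$$ Assumptions on the coefficients. $[\cdot]$ is the integer part; $a_n\asymp b_n$ means that $a_n/b_n$ is bounded between two positive constants. A1: for each $n$ the sequence $\kappa_{nj}^2$, $j\ge1$, is decreasing. A2: there are positive constants $C_1,C_2$ such that $C_1<A_n=\sigma^{-4}n^2\sum_{j=1}^\infty\kappa_{nj}^4<C_2$ for each $n$.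 A3: there are positive constants $c_1,c_2$ such that $c_1n^{-2r}\le\rho_n\le c_2n^{-2r}$. Put $k_n=\sup\{k:\sum_{j<k}\kappa_{nj}^2\le\frac12\rho_n\}$ and $\kappa_n^2=\kappa_{nk_n}^2$. A4: there are $C_1$ and $\lambda>1$ such that $\kappa^2_{n,[(1+\delta)k_n]}<C_1(1+\delta)^{-\lambda}\kappa_n^2$ for any $\delta>0$ and each $n$. A5: $\kappa_{n1}^2\asymp\kappa_n^2$ as $n\to\infty$, and for any $c>1$ there is $C>0$ such that $\kappa_{n,[ck_n]}^2\ge C\kappa_n^2$ for all $n$. Tests. A test $K_n$ generated by $T_n$ rejects the hypothesis when $T_n$ exceeds a threshold; $\alpha(K_n)$ is its type I error probability and $\beta(K_n,f)$ its type II error probability at $f$. A sequence $f_n$ is consistent if for any $\alpha\in(0,1)$, for tests $K_n$ generated by $T_n$ with $\alpha(K_n)=\alpha(1+o(1))$, one has $\limsup_{n\to\infty}\beta(K_n,f_n)<1-\alpha$. *)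

theory Defs
  imports "HOL-Probability.Probability"
begin

text \<open>Sequences indexed by \<open>j \<ge> 1\<close> are functions on \<^typ>\<open>nat\<close> whose value at \<open>0\<close> is ignored;
  accordingly \<open>\<Sum>j. a (Suc j)\<close> renders a series starting at \<open>j = 1\<close>. The sample size is \<open>n \<ge> 1\<close>.\<close>

section \<open>The space of square integrable signals\<close>

abbreviation M01 :: "real measure" where
  "M01 \<equiv> lebesgue_on {0<..<1}"

definition L2_01 :: "(real \<Rightarrow> real) set" where
  "L2_01 = {g \<in> borel_measurable M01. integrable M01 (\<lambda>t. (g t)\<^sup>2)}"

definition L2_inner :: "(real \<Rightarrow> real) \<Rightarrow> (real \<Rightarrow> real) \<Rightarrow> real" where
  "L2_inner g h = (LINT t|M01. g t * h t)"

definition L2_norm :: "(real \<Rightarrow> real) \<Rightarrow> real" where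
  "L2_norm g = sqrt (L2_inner g g)"

definition orthonormal_on :: "nat set \<Rightarrow> (nat \<Rightarrow> real \<Rightarrow> real) \<Rightarrow> bool" where
  "orthonormal_on J e \<longleftrightarrow> (\<forall>i\<in>J. e i \<in> L2_01) \<and>
     (\<forall>i\<in>J. \<forall>j\<in>J. L2_inner (e i) (e j) = (if i = j then 1 else 0))"

definition orthonormal_basis :: "(nat \<Rightarrow> real \<Rightarrow> real) \<Rightarrow> bool" where
  "orthonormal_basis \<phi> \<longleftrightarrow> orthonormal_on {1..} \<phi> \<and>
     (\<forall>g\<in>L2_01. (\<lambda>N. L2_norm (\<lambda>t. g t - (\<Sum>j=1..N. L2_inner g (\<phi> j) * \<phi> j t))) \<longlonglongrightarrow> 0)"

section \<open>Observations in Gaussian white noise\<close>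

text \<open>\<open>W g\<close> stands for the stochastic integral of \<open>g\<close> against \<open>dw\<close> over \<open>[0,1]\<close>: \<open>W\<close> is the
  isonormal Gaussian process over $L_2(0,1)$, i.e. an (almost surely) linear map sending orthonormal
  families to independent standard Gaussian variables.\<close>

definition white_noise :: "'a measure \<Rightarrow> ((real \<Rightarrow> real) \<Rightarrow> 'a \<Rightarrow> real) \<Rightarrow> bool" where
  "white_noise M W \<longleftrightarrow> prob_space M \<and>
     (\<forall>g\<in>L2_01. W g \<in> borel_measurable M) \<and>
     (\<forall>g\<in>L2_01. \<forall>h\<in>L2_01. \<forall>a b. AE \<omega> in M. W (\<lambda>t. a * g t + b * h t) \<omega> = a * W g \<omega> + b * W h \<omega>) \<and>
     (\<forall>J e. orthonormal_on J e \<longrightarrow>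
        prob_space.indep_vars M (\<lambda>_. borel) (\<lambda>i. W (e i)) J \<and>
        (\<forall>i\<in>J. distributed M lborel (W (e i)) std_normal_density))"

text \<open>The integral of \<open>g\<close> against \<open>dY\<^sub>n\<close>, where \<open>dY\<^sub>n(t) = f(t) dt + (\<sigma> / sqrt n) dw(t)\<close>.\<close>

definition obs :: "real \<Rightarrow> ((real \<Rightarrow> real) \<Rightarrow> 'a \<Rightarrow> real) \<Rightarrow> nat \<Rightarrow> (real \<Rightarrow> real) \<Rightarrow> (real \<Rightarrow> real) \<Rightarrow> 'a \<Rightarrow> real" where
  "obs \<sigma> W n f g \<omega> = L2_inner f g + \<sigma> / sqrt (real n) * W g \<omega>"

section \<open>The coefficients of the quadratic test statistics\<close>

definition rho :: "(nat \<Rightarrow> nat \<Rightarrow> real) \<Rightarrow> nat \<Rightarrow> real" where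
  "rho \<kappa> n = (\<Sum>j. (\<kappa> n (Suc j))\<^sup>2)"

definition A_coef :: "real \<Rightarrow> (nat \<Rightarrow> nat \<Rightarrow> real) \<Rightarrow> nat \<Rightarrow> real" where
  "A_coef \<sigma> \<kappa> n = (real n)\<^sup>2 / \<sigma> ^ 4 * (\<Sum>j. \<kappa> n (Suc j) ^ 4)"

definition k_idx :: "(nat \<Rightarrow> nat \<Rightarrow> real) \<Rightarrow> nat \<Rightarrow> nat" where
  "k_idx \<kappa> n = Sup {k. 1 \<le> k \<and> (\<Sum>j=1..<k. (\<kappa> n j)\<^sup>2) \<le> rho \<kappa> n / 2}"

definition kappa_sq :: "(nat \<Rightarrow> nat \<Rightarrow> real) \<Rightarrow> nat \<Rightarrow> real" where
  "kappa_sq \<kappa> n = (\<kappa> n (k_idx \<kappa> n))\<^sup>2"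

definition same_order :: "(nat \<Rightarrow> real) \<Rightarrow> (nat \<Rightarrow> real) \<Rightarrow> bool" where
  "same_order a b \<longleftrightarrow> (\<exists>c C. 0 < c \<and> 0 < C \<and>
     (\<forall>\<^sub>F n in sequentially. c \<le> a n / b n \<and> a n / b n \<le> C))"

definition A1 :: "(nat \<Rightarrow> nat \<Rightarrow> real) \<Rightarrow> bool" where
  "A1 \<kappa> \<longleftrightarrow> (\<forall>n\<ge>1. \<forall>i\<ge>1. \<forall>j\<ge>i. (\<kappa> n j)\<^sup>2 \<le> (\<kappa> n i)\<^sup>2)"

definition A2 :: "real \<Rightarrow> (nat \<Rightarrow> nat \<Rightarrow> real) \<Rightarrow> bool" where
  "A2 \<sigma> \<kappa> \<longleftrightarrow> (\<exists>C1>0. \<exists>C2>0. \<forall>n\<ge>1. C1 < A_coef \<sigma> \<kappa> n \<and> A_coef \<sigma> \<kappa> n < C2)"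

text \<open>Finiteness of \<open>rho\<close> has to be stated separately, as \<^const>\<open>suminf\<close> is total.\<close>

definition A3 :: "real \<Rightarrow> (nat \<Rightarrow> nat \<Rightarrow> real) \<Rightarrow> bool" where
  "A3 r \<kappa> \<longleftrightarrow> (\<forall>n\<ge>1. summable (\<lambda>j. (\<kappa> n (Suc j))\<^sup>2)) \<and>
     (\<exists>c1>0. \<exists>c2>0. \<forall>n\<ge>1. c1 * real n powr (- 2 * r) \<le> rho \<kappa> n \<and>
        rho \<kappa> n \<le> c2 * real n powr (- 2 * r))"

definition A4 :: "(nat \<Rightarrow> nat \<Rightarrow> real) \<Rightarrow> bool" where
  "A4 \<kappa> \<longleftrightarrow> (\<exists>C1. \<exists>l>1. \<forall>\<delta>>0. \<forall>n\<ge>1.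
     (\<kappa> n (nat \<lfloor>(1 + \<delta>) * real (k_idx \<kappa> n)\<rfloor>))\<^sup>2 < C1 * (1 + \<delta>) powr (- l) * kappa_sq \<kappa> n)"

definition A5 :: "(nat \<Rightarrow> nat \<Rightarrow> real) \<Rightarrow> bool" where
  "A5 \<kappa> \<longleftrightarrow> same_order (\<lambda>n. (\<kappa> n 1)\<^sup>2) (kappa_sq \<kappa>) \<and>
     (\<forall>c>1. \<exists>C>0. \<forall>n\<ge>1. (\<kappa> n (nat \<lfloor>c * real (k_idx \<kappa> n)\<rfloor>))\<^sup>2 \<ge> C * kappa_sq \<kappa> n)"

section \<open>Tests and consistency\<close>

definition T_stat ::
  "real \<Rightarrow> ((real \<Rightarrow> real) \<Rightarrow> 'a \<Rightarrow> real) \<Rightarrow> (nat \<Rightarrow> real \<Rightarrow> real) \<Rightarrow> (nat \<Rightarrow> nat \<Rightarrow> real) \<Rightarrow>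
    nat \<Rightarrow> (real \<Rightarrow> real) \<Rightarrow> 'a \<Rightarrow> real" where
  "T_stat \<sigma> W \<phi> \<kappa> n f \<omega> =
     (\<Sum>j. (\<kappa> n (Suc j))\<^sup>2 * (obs \<sigma> W n f (\<phi> (Suc j)) \<omega>)\<^sup>2) - \<sigma>\<^sup>2 / real n * rho \<kappa> n"

text \<open>Error probabilities of the test rejecting the hypothesis \<open>f = 0\<close> when the statistic exceeds \<open>x\<close>.\<close>

definition type1_error ::
  "'a measure \<Rightarrow> real \<Rightarrow> ((real \<Rightarrow> real) \<Rightarrow> 'a \<Rightarrow> real) \<Rightarrow> (nat \<Rightarrow> real \<Rightarrow> real) \<Rightarrow> (nat \<Rightarrow> nat \<Rightarrow> real) \<Rightarrow>
    nat \<Rightarrow> real \<Rightarrow> real" where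
  "type1_error M \<sigma> W \<phi> \<kappa> n x = measure M {\<omega> \<in> space M. T_stat \<sigma> W \<phi> \<kappa> n (\<lambda>_. 0) \<omega> > x}"

definition type2_error ::
  "'a measure \<Rightarrow> real \<Rightarrow> ((real \<Rightarrow> real) \<Rightarrow> 'a \<Rightarrow> real) \<Rightarrow> (nat \<Rightarrow> real \<Rightarrow> real) \<Rightarrow> (nat \<Rightarrow> nat \<Rightarrow> real) \<Rightarrow>
    nat \<Rightarrow> real \<Rightarrow> (real \<Rightarrow> real) \<Rightarrow> real" where
  "type2_error M \<sigma> W \<phi> \<kappa> n x f = measure M {\<omega> \<in> space M. \<not> T_stat \<sigma> W \<phi> \<kappa> n f \<omega> > x}"

text \<open>The sequence \<open>x\<close> of thresholds represents the tests; \<open>\<epsilon>\<close> is the \<open>o(1)\<close> term of the level.\<close>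

definition consistent_seq ::
  "'a measure \<Rightarrow> real \<Rightarrow> ((real \<Rightarrow> real) \<Rightarrow> 'a \<Rightarrow> real) \<Rightarrow> (nat \<Rightarrow> real \<Rightarrow> real) \<Rightarrow> (nat \<Rightarrow> nat \<Rightarrow> real) \<Rightarrow>
    (nat \<Rightarrow> real \<Rightarrow> real) \<Rightarrow> bool" where
  "consistent_seq M \<sigma> W \<phi> \<kappa> f \<longleftrightarrow>
     (\<forall>\<alpha>. 0 < \<alpha> \<and> \<alpha> < 1 \<longrightarrow>
       (\<forall>x :: nat \<Rightarrow> real.
          (\<exists>\<epsilon>. \<epsilon> \<longlonglongrightarrow> 0 \<and> (\<forall>n\<ge>1. type1_error M \<sigma> W \<phi> \<kappa> n (x n) = \<alpha> * (1 + \<epsilon> n))) \<longrightarrow>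
          limsup (\<lambda>n. ereal (type2_error M \<sigma> W \<phi> \<kappa> n (x n) (f n))) < ereal (1 - \<alpha>)))"

end

theory Submission
  imports Defs
begin

text \<open>
  The statistic is a weighted sum of squares of Gaussian coordinates. Put \<open>s = \<sigma> / sqrt n\<close>,
  \<open>S\<^sub>n = (\<Sum>j. \<kappa>\<^sub>n\<^sub>j\<^sup>4)\<close> and \<open>v\<^sub>n = sqrt (2 S\<^sub>n)\<close>. Expanding \<open>y\<^sub>j\<^sup>2 = (\<theta>\<^sub>j + s \<xi>\<^sub>j)\<^sup>2\<close> and dividing by
  \<open>s\<^sup>2 v\<^sub>n\<close>, which is of order \<open>n\<^sup>-\<^sup>2\<close>, one gets \<open>Z\<^sub>n + \<delta>\<^sub>n + R\<^sub>n\<close> (lemma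
  \<open>quadratic_statistic_decomposition\<close>), where

  \<^item> \<open>Z\<^sub>n\<close>, the standardised sum of the \<open>\<kappa>\<^sub>n\<^sub>j\<^sup>2 (\<xi>\<^sub>j\<^sup>2 - 1)\<close>, does not depend on the signal and is
    asymptotically standard normal, because the largest weight \<open>\<kappa>\<^sub>n\<^sub>1\<^sup>2 / v\<^sub>n\<close> tends to 0
    (\<open>weighted_chi_square_clt\<close>);
  \<^item> \<open>\<delta>\<^sub>n\<close> is the deterministic shift, of the order of \<open>n\<^sup>2 D\<^sub>n\<close> with
    \<open>D\<^sub>n = (\<Sum>j. \<kappa>\<^sub>n\<^sub>j\<^sup>2 \<theta>\<^sub>n\<^sub>j\<^sup>2)\<close>;
  \<^item> \<open>R\<^sub>n\<close> is linear in the noise, and its variance is at most of order \<open>n powr (2 r - 1)\<close>, so that it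
    vanishes in probability for \<open>r < 1/2\<close> (\<open>linear_series_deviation_bound\<close>).

  Hence testing with \<open>T\<^sub>n\<close> is asymptotically testing the mean of a normal variable with unit
  variance, and the alternatives are consistent exactly if \<open>\<delta>\<^sub>n\<close>, equivalently \<open>n\<^sup>2 D\<^sub>n\<close>, is
  eventually bounded away from 0 (\<open>asymptotically_normal_shift_detectable_iff\<close>).

  The orders of magnitude come from comparing second and fourth powers. The first \<open>k\<^sub>n\<close> squared
  coefficients are at least \<open>\<kappa>\<^sub>n\<^sup>2\<close> and carry at least half of \<open>\<rho>\<^sub>n\<close>, so
  \<open>\<kappa>\<^sub>n\<^sup>2 \<rho>\<^sub>n / 2 \<le> S\<^sub>n \<le> \<kappa>\<^sub>n\<^sub>1\<^sup>2 \<rho>\<^sub>n\<close>; as \<open>S\<^sub>n\<close> has order \<open>n\<^sup>-\<^sup>2\<close>, \<open>\<rho>\<^sub>n\<close> has order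
  \<open>n powr (- 2 r)\<close> and \<open>\<kappa>\<^sub>n\<^sub>1\<^sup>2\<close> is comparable with \<open>\<kappa>\<^sub>n\<^sup>2\<close>, both of these have order
  \<open>n powr (2 r - 2)\<close> (\<open>coefficient_orders\<close>).

  Finally \<open>n\<^sup>2 D\<^sub>n\<close> is bounded away from 0 if and only if the energy of the signal in the first
  \<open>c\<^sub>2 k\<^sub>n\<close> coordinates has the full order \<open>n powr (- 2 r)\<close>: on these coordinates the weights are
  of order \<open>\<kappa>\<^sub>n\<^sup>2\<close>, and the polynomial decay of the weights makes the contribution of the
  remaining ones to \<open>n\<^sup>2 D\<^sub>n\<close> as small as desired when \<open>c\<^sub>2\<close> is large
  (\<open>weighted_sum_separated_iff\<close>).
\<close>

section \<open>Weighted sums of centred chi-square variables\<close>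

text \<open>
  The upper bound amounts to \<open>1 \<le> (1 - x + x\<^sup>2 / 2) * exp x\<close>, which follows from the quadratic
  Taylor bound for \<open>exp x\<close>, as \<open>(1 - x + x\<^sup>2 / 2) * (1 + x + x\<^sup>2 / 2) = 1 + x ^ 4 / 4\<close>.
\<close>

lemma exp_minus_second_order:
  fixes x :: real
  assumes "0 \<le> x"
  shows "\<bar>exp (- x) - (1 - x)\<bar> \<le> x\<^sup>2 / 2"
proof -
  have "1 \<le> (1 - x + x\<^sup>2 / 2) * (1 + x + x\<^sup>2 / 2)"
  proof -
    have "(1 - x + x\<^sup>2 / 2) * (1 + x + x\<^sup>2 / 2) = 1 + x ^ 4 / 4"
      by (simp add: field_simps power2_eq_square eval_nat_numeral)
    then show ?thesis by simp
  qed
  also have "\<dots> \<le> (1 - x + x\<^sup>2 / 2) * exp x"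
  proof (intro mult_left_mono exp_lower_Taylor_quadratic assms)
    have "1 - x + x\<^sup>2 / 2 = ((1 - x)\<^sup>2 + 1) / 2" by (simp add: power2_eq_square field_simps)
    moreover have "0 \<le> ((1 - x)\<^sup>2 + 1) / 2" by simp
    ultimately show "0 \<le> 1 - x + x\<^sup>2 / 2" by linarith
  qed
  finally have "exp (- x) \<le> 1 - x + x\<^sup>2 / 2"
    by (simp add: exp_minus field_simps)
  moreover have "1 - x \<le> exp (- x)"
    using exp_ge_add_one_self[of "- x"] by simp
  ultimately show ?thesis by simp
qed

text \<open>
  The coordinates of white noise with respect to an orthonormal basis. The distribution of the test
  statistic depends on the noise only through them.
\<close>

locale gaussian_sequence = prob_space M for M :: "'a measure" +
  fixes \<xi> :: "nat \<Rightarrow> 'a \<Rightarrow> real"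
  assumes indep: "indep_vars (\<lambda>_. borel) \<xi> UNIV"
    and std_normal: "distributed M lborel (\<xi> j) std_normal_density"
begin

lemma measurable_xi [measurable]: "\<xi> j \<in> borel_measurable M"
  using indep unfolding indep_vars_def2 by simp

lemma integrable_xi_power: "integrable M (\<lambda>\<omega>. \<xi> j \<omega> ^ k)"
  using distributed_integrable[OF std_normal, of "\<lambda>x. x ^ k" j] integrable_std_normal_moment[of k]
  by simp

lemma expectation_xi_power: "expectation (\<lambda>\<omega>. \<xi> j \<omega> ^ k) = (LINT x|lborel. std_normal_density x * x ^ k)"
  using distributed_integral[OF std_normal, of "\<lambda>x. x ^ k" j] by simp

lemma expectation_xi: "expectation (\<xi> j) = 0"
  using expectation_xi_power[of j 1] integral_std_normal_moment_odd[of 0] by simp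

lemma expectation_xi_square: "expectation (\<lambda>\<omega>. (\<xi> j \<omega>)\<^sup>2) = 1"
  using expectation_xi_power[of j 2] integral_std_normal_moment_even[of 1] by simp

lemma expectation_xi_fourth: "expectation (\<lambda>\<omega>. (\<xi> j \<omega>) ^ 4) = 3"
  using expectation_xi_power[of j 4] integral_std_normal_moment_even[of 2] by (simp add: fact_numeral)

lemma integrable_xi_square: "integrable M (\<lambda>\<omega>. (\<xi> j \<omega>)\<^sup>2)"
  by (rule integrable_xi_power)

lemma integrable_chi: "integrable M (\<lambda>\<omega>. (\<xi> j \<omega>)\<^sup>2 - 1)"
  by (simp add: integrable_xi_square)

lemma expectation_chi: "expectation (\<lambda>\<omega>. (\<xi> j \<omega>)\<^sup>2 - 1) = 0"
  by (simp add: integrable_xi_square expectation_xi_square prob_space)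

lemma integrable_chi_square: "integrable M (\<lambda>\<omega>. ((\<xi> j \<omega>)\<^sup>2 - 1)\<^sup>2)"
  by (simp add: power2_diff integrable_xi_square integrable_xi_power flip: power_mult)

lemma expectation_chi_square: "expectation (\<lambda>\<omega>. ((\<xi> j \<omega>)\<^sup>2 - 1)\<^sup>2) = 2"
  by (simp add: power2_diff integrable_xi_square integrable_xi_power expectation_xi_fourth
      expectation_xi_square prob_space flip: power_mult)

text \<open>The coordinates are identically distributed, so the index 0 represents all of them.\<close>

definition chi_third_moment :: real where
  "chi_third_moment = expectation (\<lambda>\<omega>. \<bar>(\<xi> 0 \<omega>)\<^sup>2 - 1\<bar> ^ 3)"

lemma integrable_chi_cube: "integrable M (\<lambda>\<omega>. \<bar>(\<xi> j \<omega>)\<^sup>2 - 1\<bar> ^ 3)"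
proof (rule Bochner_Integration.integrable_bound[where f = "\<lambda>\<omega>. ((\<xi> j \<omega>)\<^sup>2 + 1) ^ 3"])
  have "(\<lambda>\<omega>. ((\<xi> j \<omega>)\<^sup>2 + 1) ^ 3) = (\<lambda>\<omega>. \<xi> j \<omega> ^ 6 + 3 * \<xi> j \<omega> ^ 4 + 3 * \<xi> j \<omega> ^ 2 + 1)"
    by (simp add: fun_eq_iff algebra_simps power2_eq_square eval_nat_numeral)
  then show "integrable M (\<lambda>\<omega>. ((\<xi> j \<omega>)\<^sup>2 + 1) ^ 3)"
    by (simp add: integrable_xi_power)
  have "\<bar>x\<^sup>2 - 1\<bar> ^ 3 \<le> (x\<^sup>2 + 1) ^ 3" for x :: real
  proof (rule power_mono)
    show "\<bar>x\<^sup>2 - 1\<bar> \<le> x\<^sup>2 + 1"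
      using zero_le_power2[of x] by linarith
  qed simp
  then show "AE \<omega> in M. norm (\<bar>(\<xi> j \<omega>)\<^sup>2 - 1\<bar> ^ 3) \<le> norm (((\<xi> j \<omega>)\<^sup>2 + 1) ^ 3)"
    by (intro AE_I2) (smt (verit) norm_power real_norm_def power_abs abs_ge_zero abs_of_nonneg zero_le_power)
qed measurable

lemma chi_third_moment: "expectation (\<lambda>\<omega>. \<bar>(\<xi> j \<omega>)\<^sup>2 - 1\<bar> ^ 3) = chi_third_moment"
  using distributed_integral[OF std_normal, of "\<lambda>x. \<bar>x\<^sup>2 - 1\<bar> ^ 3" j]
    distributed_integral[OF std_normal, of "\<lambda>x. \<bar>x\<^sup>2 - 1\<bar> ^ 3" 0]
  by (simp add: chi_third_moment_def)

lemma chi_third_moment_nonneg: "0 \<le> chi_third_moment"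
  unfolding chi_third_moment_def by (intro integral_nonneg_AE AE_I2) simp

text \<open>
  Second order expansion of the characteristic function: \<open>\<xi> j ^ 2 - 1\<close> has mean 0, variance 2 and a
  finite third absolute moment. The weight \<open>a\<close> only rescales the argument.
\<close>

lemma char_chi_approx:
  "cmod (char (distr M borel (\<lambda>\<omega>. a * ((\<xi> j \<omega>)\<^sup>2 - 1))) t - (1 - (t * a)\<^sup>2)) \<le> \<bar>t * a\<bar> ^ 3 * chi_third_moment"
proof -
  have eq: "char (distr M borel (\<lambda>\<omega>. a * ((\<xi> j \<omega>)\<^sup>2 - 1))) t = char (distr M borel (\<lambda>\<omega>. (\<xi> j \<omega>)\<^sup>2 - 1)) (t * a)"
    by (simp add: char_def integral_distr mult.assoc)
  have "cmod (char (distr M borel (\<lambda>\<omega>. (\<xi> j \<omega>)\<^sup>2 - 1)) (t * a) - (1 - (t * a)\<^sup>2 * 2 / 2)) \<le>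
    (t * a)\<^sup>2 / 6 * expectation (\<lambda>\<omega>. min (6 * ((\<xi> j \<omega>)\<^sup>2 - 1)\<^sup>2) (\<bar>t * a\<bar> * \<bar>(\<xi> j \<omega>)\<^sup>2 - 1\<bar> ^ 3))"
    using integrable_chi expectation_chi integrable_chi_square expectation_chi_square
    by (intro char_approx3') auto
  also have "\<dots> \<le> (t * a)\<^sup>2 / 6 * expectation (\<lambda>\<omega>. \<bar>t * a\<bar> * \<bar>(\<xi> j \<omega>)\<^sup>2 - 1\<bar> ^ 3)"
  proof (intro mult_left_mono integral_mono integrable_mult_right integrable_chi_cube)
    show "integrable M (\<lambda>\<omega>. min (6 * ((\<xi> j \<omega>)\<^sup>2 - 1)\<^sup>2) (\<bar>t * a\<bar> * \<bar>(\<xi> j \<omega>)\<^sup>2 - 1\<bar> ^ 3))"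
      by (intro integrable_min integrable_mult_right integrable_chi_cube integrable_chi_square)
  qed auto
  also have "\<dots> = ((t * a)\<^sup>2 * \<bar>t * a\<bar> * chi_third_moment) / 6"
    by (simp add: chi_third_moment)
  also have "(t * a)\<^sup>2 * \<bar>t * a\<bar> = \<bar>t * a\<bar> ^ 3"
    by (simp add: power3_eq_cube power2_eq_square abs_mult_self_eq)
  also have "\<bar>t * a\<bar> ^ 3 * chi_third_moment / 6 \<le> \<bar>t * a\<bar> ^ 3 * chi_third_moment"
    using mult_nonneg_nonneg[of "\<bar>t * a\<bar> ^ 3" chi_third_moment] chi_third_moment_nonneg by simp
  finally show ?thesis by (simp add: eq)
qed

text \<open>
  The series of nonnegative terms has the finite expectation \<open>\<Sum>j. a j\<close>.
\<close>

lemma AE_summable_weighted_squares: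
  assumes "\<And>j. 0 \<le> a j" "summable a"
  shows "AE \<omega> in M. summable (\<lambda>j. a j * (\<xi> j \<omega>)\<^sup>2)"
proof -
  have "(\<integral>\<^sup>+\<omega>. (\<Sum>j. ennreal (a j * (\<xi> j \<omega>)\<^sup>2)) \<partial>M) = (\<Sum>j. \<integral>\<^sup>+\<omega>. ennreal (a j * (\<xi> j \<omega>)\<^sup>2) \<partial>M)"
    by (intro nn_integral_suminf) measurable
  also have "\<dots> = (\<Sum>j. ennreal (a j))"
  proof (rule suminf_cong)
    fix j
    have "(\<integral>\<^sup>+\<omega>. ennreal (a j * (\<xi> j \<omega>)\<^sup>2) \<partial>M) = ennreal (expectation (\<lambda>\<omega>. a j * (\<xi> j \<omega>)\<^sup>2))"
      using assms by (intro nn_integral_eq_integral integrable_mult_right integrable_xi_square) auto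
    then show "(\<integral>\<^sup>+\<omega>. ennreal (a j * (\<xi> j \<omega>)\<^sup>2) \<partial>M) = ennreal (a j)"
      by (simp add: expectation_xi_square)
  qed
  also have "\<dots> \<noteq> \<infinity>"
    using assms by (simp add: suminf_ennreal2)
  finally have "AE \<omega> in M. (\<Sum>j. ennreal (a j * (\<xi> j \<omega>)\<^sup>2)) \<noteq> \<infinity>"
    by (intro nn_integral_PInf_AE) auto
  then show ?thesis
    using assms by (auto intro!: summable_suminf_not_top)
qed

text \<open>
  Both sides are products of factors of modulus at most 1, so the difference is at most the sum of
  the differences of the factors. Each of these passes through \<open>1 - (t * a j)\<^sup>2\<close>, the common second
  order expansion: the cubic term bounds the error for the chi-square factor and the quartic term
  that for the Gaussian factor.
\<close>

lemma char_weighted_chi_sum_approx: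
  assumes "\<And>j. 0 \<le> a j"
  shows "cmod (char (distr M borel (\<lambda>\<omega>. \<Sum>j<N. a j * ((\<xi> j \<omega>)\<^sup>2 - 1))) t
       - complex_of_real (exp (- (t\<^sup>2 * (\<Sum>j<N. (a j)\<^sup>2)))))
     \<le> (\<Sum>j<N. chi_third_moment * \<bar>t\<bar> ^ 3 * a j ^ 3 + t ^ 4 * a j ^ 4)"
proof -
  let ?X = "\<lambda>j \<omega>. a j * ((\<xi> j \<omega>)\<^sup>2 - 1)"
  let ?u = "\<lambda>j. char (distr M borel (?X j)) t"
  let ?v = "\<lambda>j. complex_of_real (exp (- (t * a j)\<^sup>2))"
  have "char (distr M borel (\<lambda>\<omega>. \<Sum>j<N. ?X j \<omega>)) t = (\<Prod>j<N. ?u j)"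
    by (rule char_distr_sum, rule indep_vars_compose2[OF indep_vars_subset[OF indep]]) auto
  moreover have "complex_of_real (exp (- (t\<^sup>2 * (\<Sum>j<N. (a j)\<^sup>2)))) = (\<Prod>j<N. ?v j)"
    by (simp add: exp_sum sum_distrib_left power_mult_distrib flip: sum_negf of_real_prod)
  moreover have "cmod ((\<Prod>j<N. ?u j) - (\<Prod>j<N. ?v j)) \<le> (\<Sum>j<N. cmod (?u j - ?v j))"
    by (intro norm_prod_diff real_distribution.cmod_char_le_1 real_distribution_distr) auto
  moreover have "cmod (?u j - ?v j) \<le> chi_third_moment * \<bar>t\<bar> ^ 3 * a j ^ 3 + t ^ 4 * a j ^ 4" for j
  proof -
    have "cmod (?u j - ?v j) \<le> cmod (?u j - (1 - (t * a j)\<^sup>2)) + cmod (complex_of_real (1 - (t * a j)\<^sup>2) - ?v j)"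
      using norm_triangle_ineq[of "?u j - (1 - (t * a j)\<^sup>2)" "complex_of_real (1 - (t * a j)\<^sup>2) - ?v j"] by simp
    also have "cmod (complex_of_real (1 - (t * a j)\<^sup>2) - ?v j) = \<bar>exp (- (t * a j)\<^sup>2) - (1 - (t * a j)\<^sup>2)\<bar>"
      by (metis abs_minus_commute norm_of_real of_real_diff)
    also have "\<dots> \<le> ((t * a j)\<^sup>2)\<^sup>2 / 2"
      by (intro exp_minus_second_order) simp
    also have "\<dots> \<le> t ^ 4 * a j ^ 4"
      by (simp add: power_mult_distrib flip: power_mult)
    also have "cmod (?u j - (1 - (t * a j)\<^sup>2)) \<le> chi_third_moment * \<bar>t\<bar> ^ 3 * a j ^ 3"
      using char_chi_approx[of "a j" j t] assms[of j] by (simp add: abs_mult power_mult_distrib mult_ac)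
    finally show ?thesis by simp
  qed
  ultimately show ?thesis
    by (smt (verit, ccfv_SIG) sum_mono)
qed

text \<open>
  The bound for partial sums does not depend on their length, because third and fourth powers of the
  weights are dominated by \<open>m\<close> and \<open>m\<^sup>2\<close> times their squares; so it survives the limit. As each
  \<open>\<xi> j ^ 2 - 1\<close> has variance 2, squared weights summing to \<open>1/2\<close> give unit variance.
\<close>

lemma char_weighted_chi_series_approx:
  assumes a: "\<And>j. 0 \<le> a j" "summable a" and sq: "(\<lambda>j. (a j)\<^sup>2) sums (1/2)" and le: "\<And>j. a j \<le> m"
  shows "cmod (char (distr M borel (\<lambda>\<omega>. \<Sum>j. a j * ((\<xi> j \<omega>)\<^sup>2 - 1))) t - char std_normal_distribution t)
     \<le> chi_third_moment * \<bar>t\<bar> ^ 3 * m + t ^ 4 * m\<^sup>2"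
proof -
  let ?S = "\<lambda>N \<omega>. \<Sum>j<N. a j * ((\<xi> j \<omega>)\<^sup>2 - 1)"
  let ?Z = "\<lambda>\<omega>. \<Sum>j. a j * ((\<xi> j \<omega>)\<^sup>2 - 1)"
  have m: "0 \<le> m" using a(1)[of 0] le[of 0] by simp
  have lim: "AE \<omega> in M. (\<lambda>N. ?S N \<omega>) \<longlonglongrightarrow> ?Z \<omega>"
    using AE_summable_weighted_squares[OF a]
  proof eventually_elim
    case (elim \<omega>)
    then have "summable (\<lambda>j. a j * ((\<xi> j \<omega>)\<^sup>2 - 1))"
      using summable_diff[OF elim a(2)] by (simp add: algebra_simps)
    then show ?case by (rule summable_LIMSEQ)
  qed
  have "(\<lambda>N. char (distr M borel (?S N)) t) \<longlonglongrightarrow> char (distr M borel ?Z) t"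
  proof -
    have "(\<lambda>N. CLINT \<omega>|M. iexp (t * ?S N \<omega>)) \<longlonglongrightarrow> (CLINT \<omega>|M. iexp (t * ?Z \<omega>))"
    proof (rule integral_dominated_convergence[where w = "\<lambda>_. 1"])
      show "AE \<omega> in M. (\<lambda>N. iexp (t * ?S N \<omega>)) \<longlonglongrightarrow> iexp (t * ?Z \<omega>)"
        using lim by eventually_elim (intro tendsto_intros)
    qed auto
    then show ?thesis by (simp add: char_def integral_distr)
  qed
  moreover have "(\<lambda>N. complex_of_real (exp (- (t\<^sup>2 * (\<Sum>j<N. (a j)\<^sup>2))))) \<longlonglongrightarrow> char std_normal_distribution t"
  proof -
    have "(\<lambda>N. complex_of_real (exp (- (t\<^sup>2 * (\<Sum>j<N. (a j)\<^sup>2))))) \<longlonglongrightarrow> complex_of_real (exp (- (t\<^sup>2 * (1 / 2))))"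
      using sq unfolding sums_def by (intro tendsto_intros)
    then show ?thesis by (simp add: char_std_normal_distribution)
  qed
  ultimately have conv: "(\<lambda>N. cmod (char (distr M borel (?S N)) t - complex_of_real (exp (- (t\<^sup>2 * (\<Sum>j<N. (a j)\<^sup>2))))))
      \<longlonglongrightarrow> cmod (char (distr M borel ?Z) t - char std_normal_distribution t)"
    by (intro tendsto_norm tendsto_diff)
  have "cmod (char (distr M borel (?S N)) t - complex_of_real (exp (- (t\<^sup>2 * (\<Sum>j<N. (a j)\<^sup>2)))))
      \<le> chi_third_moment * \<bar>t\<bar> ^ 3 * m + t ^ 4 * m\<^sup>2" for N
  proof -
    have half: "(\<Sum>j<N. (a j)\<^sup>2) \<le> 1 / 2"
      using sum_le_suminf[OF sums_summable[OF sq], of "{..<N}"] sums_unique[OF sq] by simp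
    have cube: "a j ^ 3 \<le> m * (a j)\<^sup>2" and fourth: "a j ^ 4 \<le> m\<^sup>2 * (a j)\<^sup>2" for j
    proof -
      show "a j ^ 3 \<le> m * (a j)\<^sup>2"
        using mult_right_mono[OF le[of j], of "(a j)\<^sup>2"] by (simp add: power3_eq_cube power2_eq_square)
      have "(a j)\<^sup>2 \<le> m\<^sup>2" using a(1) le by (intro power_mono)
      then show "a j ^ 4 \<le> m\<^sup>2 * (a j)\<^sup>2"
        using mult_right_mono[of "(a j)\<^sup>2" "m\<^sup>2" "(a j)\<^sup>2"] by (simp add: power4_eq_xxxx power2_eq_square mult.assoc)
    qed
    have "cmod (char (distr M borel (?S N)) t - complex_of_real (exp (- (t\<^sup>2 * (\<Sum>j<N. (a j)\<^sup>2)))))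
      \<le> (\<Sum>j<N. chi_third_moment * \<bar>t\<bar> ^ 3 * a j ^ 3 + t ^ 4 * a j ^ 4)"
      by (rule char_weighted_chi_sum_approx[OF a(1)])
    also have "\<dots> \<le> (\<Sum>j<N. chi_third_moment * \<bar>t\<bar> ^ 3 * (m * (a j)\<^sup>2) + t ^ 4 * (m\<^sup>2 * (a j)\<^sup>2))"
      using chi_third_moment_nonneg cube fourth
      by (intro sum_mono add_mono mult_left_mono) auto
    also have "\<dots> = (chi_third_moment * \<bar>t\<bar> ^ 3 * m + t ^ 4 * m\<^sup>2) * (\<Sum>j<N. (a j)\<^sup>2)"
      by (simp add: sum_distrib_left sum.distrib algebra_simps)
    also have "\<dots> \<le> (chi_third_moment * \<bar>t\<bar> ^ 3 * m + t ^ 4 * m\<^sup>2) * 1"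
      using half chi_third_moment_nonneg m by (intro mult_left_mono) auto
    finally show ?thesis by simp
  qed
  then show ?thesis
    by (intro LIMSEQ_le_const2[OF conv]) auto
qed

text \<open>
  A central limit theorem for a triangular array with infinite rows. No single summand matters in
  the limit because the largest weight \<open>m n\<close> vanishes.
\<close>

theorem weighted_chi_square_clt:
  assumes a: "\<forall>\<^sub>F n in sequentially. (\<forall>j. 0 \<le> a n j \<and> a n j \<le> m n) \<and> summable (a n) \<and> (\<lambda>j. (a n j)\<^sup>2) sums (1/2)"
    and m: "m \<longlonglongrightarrow> 0"
  shows "weak_conv_m (\<lambda>n. distr M borel (\<lambda>\<omega>. \<Sum>j. a n j * ((\<xi> j \<omega>)\<^sup>2 - 1))) std_normal_distribution"
proof (rule levy_continuity)
  fix t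
  let ?c = "\<lambda>n. char (distr M borel (\<lambda>\<omega>. \<Sum>j. a n j * ((\<xi> j \<omega>)\<^sup>2 - 1))) t"
  have "(\<lambda>n. chi_third_moment * \<bar>t\<bar> ^ 3 * m n + t ^ 4 * (m n)\<^sup>2) \<longlonglongrightarrow> chi_third_moment * \<bar>t\<bar> ^ 3 * 0 + t ^ 4 * 0\<^sup>2"
    by (intro tendsto_intros m)
  then have "(\<lambda>n. chi_third_moment * \<bar>t\<bar> ^ 3 * m n + t ^ 4 * (m n)\<^sup>2) \<longlonglongrightarrow> 0"
    by simp
  then have "(\<lambda>n. ?c n - char std_normal_distribution t) \<longlonglongrightarrow> 0"
    by (rule Lim_null_comparison[rotated])
       (use a in eventually_elim, auto intro!: char_weighted_chi_series_approx)
  then show "?c \<longlonglongrightarrow> char std_normal_distribution t"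
    by (rule LIM_zero_cancel)
qed (auto intro!: real_dist_normal_dist)

section \<open>Linear forms in the noise\<close>

lemma linear_sum_second_moment:
  "integrable M (\<lambda>\<omega>. \<Sum>j<N. b j * \<xi> j \<omega>)
   \<and> integrable M (\<lambda>\<omega>. (\<Sum>j<N. b j * \<xi> j \<omega>)\<^sup>2)
   \<and> expectation (\<lambda>\<omega>. (\<Sum>j<N. b j * \<xi> j \<omega>)\<^sup>2) = (\<Sum>j<N. (b j)\<^sup>2)"
proof (induction N)
  case (Suc N)
  let ?S = "\<lambda>\<omega>. \<Sum>j<N. b j * \<xi> j \<omega>" and ?X = "\<lambda>\<omega>. b N * \<xi> N \<omega>"
  have ind: "indep_var borel ?X borel ?S"
    by (rule indep_vars_sum, simp, simp, rule indep_vars_compose2[OF indep_vars_subset[OF indep]]) auto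
  have X: "integrable M ?X" "expectation ?X = 0"
    using integrable_xi_power[of N 1] expectation_xi[of N] by auto
  have X2: "integrable M (\<lambda>\<omega>. (?X \<omega>)\<^sup>2)" "expectation (\<lambda>\<omega>. (?X \<omega>)\<^sup>2) = (b N)\<^sup>2"
    using integrable_xi_square[of N] expectation_xi_square[of N] by (auto simp: power_mult_distrib)
  have S: "integrable M ?S" "integrable M (\<lambda>\<omega>. (?S \<omega>)\<^sup>2)"
    "expectation (\<lambda>\<omega>. (?S \<omega>)\<^sup>2) = (\<Sum>j<N. (b j)\<^sup>2)"
    using Suc.IH by auto
  have XS: "integrable M (\<lambda>\<omega>. ?X \<omega> * ?S \<omega>)" "expectation (\<lambda>\<omega>. ?X \<omega> * ?S \<omega>) = 0"
    using indep_var_integrable[OF ind X(1) S(1)] indep_var_lebesgue_integral[OF ind X(1) S(1)] X(2)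
    by simp_all
  have eq: "(\<Sum>j<Suc N. b j * \<xi> j \<omega>)\<^sup>2 = (?S \<omega>)\<^sup>2 + (?X \<omega>)\<^sup>2 + 2 * (?X \<omega> * ?S \<omega>)" for \<omega>
    unfolding sum.lessThan_Suc power2_sum by (simp add: mult_ac)
  have "integrable M (\<lambda>\<omega>. (?S \<omega>)\<^sup>2 + (?X \<omega>)\<^sup>2 + 2 * (?X \<omega> * ?S \<omega>))"
    by (intro Bochner_Integration.integrable_add integrable_mult_right S X2 XS)
  moreover have "expectation (\<lambda>\<omega>. (?S \<omega>)\<^sup>2 + (?X \<omega>)\<^sup>2 + 2 * (?X \<omega> * ?S \<omega>))
     = (\<Sum>j<Suc N. (b j)\<^sup>2)"
    using S X2 XS by (subst Bochner_Integration.integral_add; simp)+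
  moreover have "integrable M (\<lambda>\<omega>. \<Sum>j<Suc N. b j * \<xi> j \<omega>)"
    unfolding sum.lessThan_Suc by (intro Bochner_Integration.integrable_add S X)
  ultimately show ?case
    unfolding eq by blast
qed simp

text \<open>
  Chebyshev's inequality. The second moment of the series is controlled by Fatou's lemma, for which
  almost sure convergence of the partial sums is enough.
\<close>

lemma linear_series_deviation_bound:
  assumes conv: "AE \<omega> in M. summable (\<lambda>j. b j * \<xi> j \<omega>)" and b: "summable (\<lambda>j. (b j)\<^sup>2)" and "0 < \<epsilon>"
  shows "prob {\<omega> \<in> space M. \<epsilon> \<le> \<bar>\<Sum>j. b j * \<xi> j \<omega>\<bar>} \<le> (\<Sum>j. (b j)\<^sup>2) / \<epsilon>\<^sup>2"
proof -
  let ?S = "\<lambda>N \<omega>. \<Sum>j<N. b j * \<xi> j \<omega>" and ?Z = "\<lambda>\<omega>. \<Sum>j. b j * \<xi> j \<omega>"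
  let ?V = "\<Sum>j. (b j)\<^sup>2"
  let ?A = "{\<omega> \<in> space M. \<epsilon> \<le> \<bar>?Z \<omega>\<bar>}"
  have [measurable]: "?A \<in> sets M" by measurable
  have "ennreal (\<epsilon>\<^sup>2 * prob ?A) = (\<integral>\<^sup>+\<omega>. ennreal (\<epsilon>\<^sup>2) * indicator ?A \<omega> \<partial>M)"
    by (simp add: nn_integral_cmult emeasure_eq_measure ennreal_mult)
  also have "\<dots> \<le> (\<integral>\<^sup>+\<omega>. liminf (\<lambda>N. ennreal ((?S N \<omega>)\<^sup>2)) \<partial>M)"
  proof (rule nn_integral_mono_AE)
    show "AE \<omega> in M. ennreal (\<epsilon>\<^sup>2) * indicator ?A \<omega> \<le> liminf (\<lambda>N. ennreal ((?S N \<omega>)\<^sup>2))"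
      using conv
    proof eventually_elim
      case (elim \<omega>)
      have "(\<lambda>N. ennreal ((?S N \<omega>)\<^sup>2)) \<longlonglongrightarrow> ennreal ((?Z \<omega>)\<^sup>2)"
        by (intro tendsto_ennrealI tendsto_power summable_LIMSEQ elim)
      then have "liminf (\<lambda>N. ennreal ((?S N \<omega>)\<^sup>2)) = ennreal ((?Z \<omega>)\<^sup>2)"
        by (rule lim_imp_Liminf[OF sequentially_bot])
      moreover have "\<epsilon>\<^sup>2 \<le> (?Z \<omega>)\<^sup>2" if "\<epsilon> \<le> \<bar>?Z \<omega>\<bar>"
        using power_mono[OF that, of 2] \<open>0 < \<epsilon>\<close> by simp
      ultimately show ?case
        by (auto simp: indicator_def intro!: ennreal_leI)
    qed
  qed
  also have "\<dots> \<le> liminf (\<lambda>N. \<integral>\<^sup>+\<omega>. ennreal ((?S N \<omega>)\<^sup>2) \<partial>M)"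
    by (rule nn_integral_liminf) measurable
  also have "\<dots> \<le> liminf (\<lambda>N. ennreal ?V)"
  proof (rule Liminf_mono, rule always_eventually, rule allI)
    fix N
    have "(\<integral>\<^sup>+\<omega>. ennreal ((?S N \<omega>)\<^sup>2) \<partial>M) = ennreal (\<Sum>j<N. (b j)\<^sup>2)"
      using linear_sum_second_moment[of b N] by (subst nn_integral_eq_integral) auto
    also have "\<dots> \<le> ennreal ?V"
      by (intro ennreal_leI sum_le_suminf b) auto
    finally show "(\<integral>\<^sup>+\<omega>. ennreal ((?S N \<omega>)\<^sup>2) \<partial>M) \<le> ennreal ?V" .
  qed
  also have "\<dots> = ennreal ?V"
    by (simp add: Liminf_const)
  finally have "\<epsilon>\<^sup>2 * prob ?A \<le> ?V"
    by (simp add: suminf_nonneg b)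
  then show ?thesis
    using \<open>0 < \<epsilon>\<close> by (simp add: field_simps)
qed

end

section \<open>Detecting a shift of an asymptotically normal statistic\<close>

lemma isCont_cdf_std_normal: "isCont (cdf std_normal_distribution) x"
proof -
  interpret N: real_distribution std_normal_distribution by (rule real_dist_normal_dist)
  have "emeasure std_normal_distribution {x} = 0"
    by (subst emeasure_density) (auto simp: nn_integral_0_iff_AE intro!: AE_I'[of "{x}"] split: split_indicator)
  then show ?thesis
    by (simp add: N.isCont_cdf measure_def)
qed

text \<open>
  The density is positive, so an interval of positive length cannot be a null set.
\<close>

lemma cdf_std_normal_strict_mono:
  assumes "x < y"
  shows "cdf std_normal_distribution x < cdf std_normal_distribution y"
proof -
  interpret N: real_distribution std_normal_distribution by (rule real_dist_normal_dist)
  have "emeasure std_normal_distribution {x<..y} \<noteq> 0"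
  proof
    assume "emeasure std_normal_distribution {x<..y} = 0"
    then have "{x<..y} \<in> null_sets std_normal_distribution"
      by auto
    then have "AE z in lborel. z \<in> {x<..y} \<longrightarrow> ennreal (std_normal_density z) = 0"
      by (subst (asm) null_sets_density_iff) auto
    then have "AE z in lborel. z \<notin> {x<..y}"
    proof eventually_elim
      case (elim z)
      then show ?case using normal_density_pos[of 1 0 z] by (auto simp: ennreal_eq_0_iff)
    qed
    then have "emeasure lborel {x<..y} = 0"
      by (subst (asm) AE_iff_measurable[of "{x<..y}"]) auto
    then show False using assms by simp
  qed
  then have "0 < measure std_normal_distribution {x<..y}"
    by (simp add: N.emeasure_eq_measure zero_less_measure_iff)
  then show ?thesis
    using N.cdf_diff_eq[OF assms] by simp
qed

lemma cdf_std_normal_bounds: "0 < cdf std_normal_distribution x" "cdf std_normal_distribution x < 1"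
proof -
  interpret N: real_distribution std_normal_distribution by (rule real_dist_normal_dist)
  show "0 < cdf std_normal_distribution x"
    using cdf_std_normal_strict_mono[of "x - 1" x] N.cdf_nonneg[of "x - 1"] by simp
  show "cdf std_normal_distribution x < 1"
    using cdf_std_normal_strict_mono[of x "x + 1"] N.cdf_bounded_prob[of "x + 1"] by simp
qed

lemma std_normal_quantile:
  assumes "0 < p" "p < 1"
  obtains z where "cdf std_normal_distribution z = p"
proof -
  interpret N: real_distribution std_normal_distribution by (rule real_dist_normal_dist)
  have "eventually (\<lambda>z. cdf std_normal_distribution z < p) at_bot"
    using N.cdf_lim_at_bot assms(1) by (rule order_tendstoD)
  then obtain a where a: "cdf std_normal_distribution a < p"
    by (auto simp: eventually_at_bot_linorder)
  have "eventually (\<lambda>z. p < cdf std_normal_distribution z) at_top"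
    using N.cdf_lim_at_top_prob assms(2) by (rule order_tendstoD)
  then obtain b where b: "p < cdf std_normal_distribution b"
    by (auto simp: eventually_at_top_linorder)
  have "a \<le> b"
    using a b N.cdf_nondecreasing[of b a] by (cases "a \<le> b") auto
  then show ?thesis
    using IVT[of "cdf std_normal_distribution" a p b] a b isCont_cdf_std_normal that by auto
qed

lemma (in prob_space) cdf_distr_tendsto:
  assumes "weak_conv_m (\<lambda>n. distr M borel (Z n)) std_normal_distribution" "\<And>n. Z n \<in> borel_measurable M"
  shows "(\<lambda>n. prob {\<omega> \<in> space M. Z n \<omega> \<le> z}) \<longlonglongrightarrow> cdf std_normal_distribution z"
proof -
  have "cdf (distr M borel (Z n)) z = prob {\<omega> \<in> space M. Z n \<omega> \<le> z}" for n
    using assms(2)[of n] unfolding cdf_def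
    by (subst measure_distr) (auto intro!: arg_cong[where f = prob])
  moreover have "(\<lambda>n. cdf (distr M borel (Z n)) z) \<longlonglongrightarrow> cdf std_normal_distribution z"
    using assms(1) isCont_cdf_std_normal unfolding weak_conv_m_def weak_conv_def by blast
  ultimately show ?thesis by simp
qed

text \<open>
  Thresholds \<open>y\<close> of asymptotic level \<open>\<alpha>\<close> are asymptotically at most the normal quantile \<open>z\<close> with
  \<open>\<Phi> z = 1 - \<alpha>\<close>, where \<open>\<Phi>\<close> is the standard normal distribution function. A shift by at least
  \<open>d > 0\<close> therefore lowers the limiting acceptance probability strictly below
  \<open>\<Phi> z\<close>, since \<open>\<Phi>\<close> is strictly increasing. If on the other hand the shifts are
  arbitrarily small infinitely often, then along those indices the shifted statistic is
  asymptotically no larger than a standard normal variable, and already the threshold 0, of level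
  \<open>1 - \<Phi> 0\<close>, gives a limit superior of at least \<open>\<Phi> 0\<close>.
\<close>

lemma (in prob_space) asymptotically_normal_shift_detectable_iff:
  fixes Z R :: "nat \<Rightarrow> 'a \<Rightarrow> real" and \<delta> :: "nat \<Rightarrow> real"
  assumes Z [measurable]: "\<And>n. Z n \<in> borel_measurable M" and R [measurable]: "\<And>n. R n \<in> borel_measurable M"
    and normal: "weak_conv_m (\<lambda>n. distr M borel (Z n)) std_normal_distribution"
    and negligible: "\<And>e. 0 < e \<Longrightarrow> (\<lambda>n. prob {\<omega> \<in> space M. e \<le> \<bar>R n \<omega>\<bar>}) \<longlonglongrightarrow> 0"
  shows "(\<forall>\<alpha>. 0 < \<alpha> \<and> \<alpha> < 1 \<longrightarrow> (\<forall>y. (\<lambda>n. prob {\<omega> \<in> space M. y n < Z n \<omega>}) \<longlonglongrightarrow> \<alpha> \<longrightarrow>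
        limsup (\<lambda>n. ereal (prob {\<omega> \<in> space M. Z n \<omega> + \<delta> n + R n \<omega> \<le> y n})) < ereal (1 - \<alpha>)))
     \<longleftrightarrow> (\<exists>d>0. \<forall>\<^sub>F n in sequentially. d \<le> \<delta> n)" (is "?detect \<longleftrightarrow> ?sep")
proof
  note cdf_lim = cdf_distr_tendsto[OF normal Z]
  let ?\<Phi> = "cdf std_normal_distribution"
  have compl: "prob {\<omega> \<in> space M. y < Z n \<omega>} = 1 - prob {\<omega> \<in> space M. Z n \<omega> \<le> y}" for n y
  proof -
    have "{\<omega> \<in> space M. y < Z n \<omega>} = space M - {\<omega> \<in> space M. Z n \<omega> \<le> y}" by auto
    then show ?thesis by (simp add: prob_compl)
  qed
  {
    assume ?sep
    then obtain d where d: "0 < d" "\<forall>\<^sub>F n in sequentially. d \<le> \<delta> n" by blast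
    show ?detect
    proof (intro allI impI)
      fix \<alpha> :: real and y :: "nat \<Rightarrow> real"
      assume \<alpha>: "0 < \<alpha> \<and> \<alpha> < 1" and level: "(\<lambda>n. prob {\<omega> \<in> space M. y n < Z n \<omega>}) \<longlonglongrightarrow> \<alpha>"
      obtain z where z: "?\<Phi> z = 1 - \<alpha>"
        using std_normal_quantile[of "1 - \<alpha>"] \<alpha> by auto
      have "\<forall>\<^sub>F n in sequentially. y n < z + d / 4"
      proof -
        \<comment> \<open>a probability strictly between the limits of the acceptance probabilities at \<open>y n\<close> and at \<open>z + d / 4\<close>\<close>
        let ?q = "(?\<Phi> z + ?\<Phi> (z + d / 4)) / 2"
        have q: "?\<Phi> z < ?q" "?q < ?\<Phi> (z + d / 4)"
          using cdf_std_normal_strict_mono[of z "z + d / 4"] d by auto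
        have "1 - ?q < \<alpha>"
          using q(1) z by linarith
        then have "\<forall>\<^sub>F n in sequentially. 1 - ?q < prob {\<omega> \<in> space M. y n < Z n \<omega>}"
          by (rule order_tendstoD(1)[OF level])
        moreover have "\<forall>\<^sub>F n in sequentially. ?q < prob {\<omega> \<in> space M. Z n \<omega> \<le> z + d / 4}"
          using order_tendstoD(1)[OF cdf_lim q(2)] .
        ultimately show ?thesis
        proof eventually_elim
          case (elim n)
          show ?case
          proof (rule ccontr)
            assume "\<not> y n < z + d / 4"
            then have "prob {\<omega> \<in> space M. Z n \<omega> \<le> z + d / 4} \<le> prob {\<omega> \<in> space M. Z n \<omega> \<le> y n}"
              by (intro finite_measure_mono) auto
            then show False using elim by (simp add: compl)
          qed
        qed
      qed
      with d(2) have "\<forall>\<^sub>F n in sequentially. prob {\<omega> \<in> space M. Z n \<omega> + \<delta> n + R n \<omega> \<le> y n}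
          \<le> prob {\<omega> \<in> space M. Z n \<omega> \<le> z - d / 4} + prob {\<omega> \<in> space M. d / 2 \<le> \<bar>R n \<omega>\<bar>}"
      proof eventually_elim
        case (elim n)
        have "prob {\<omega> \<in> space M. Z n \<omega> + \<delta> n + R n \<omega> \<le> y n}
          \<le> prob ({\<omega> \<in> space M. Z n \<omega> \<le> z - d / 4} \<union> {\<omega> \<in> space M. d / 2 \<le> \<bar>R n \<omega>\<bar>})"
          using elim by (intro finite_measure_mono) (auto simp: abs_if split: if_splits)
        also have "\<dots> \<le> prob {\<omega> \<in> space M. Z n \<omega> \<le> z - d / 4} + prob {\<omega> \<in> space M. d / 2 \<le> \<bar>R n \<omega>\<bar>}"
          by (intro measure_Un_le) auto
        finally show ?case .
      qed
      then have "\<forall>\<^sub>F n in sequentially. ereal (prob {\<omega> \<in> space M. Z n \<omega> + \<delta> n + R n \<omega> \<le> y n})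
          \<le> ereal (prob {\<omega> \<in> space M. Z n \<omega> \<le> z - d / 4} + prob {\<omega> \<in> space M. d / 2 \<le> \<bar>R n \<omega>\<bar>})"
        by simp
      then have "limsup (\<lambda>n. ereal (prob {\<omega> \<in> space M. Z n \<omega> + \<delta> n + R n \<omega> \<le> y n}))
          \<le> limsup (\<lambda>n. ereal (prob {\<omega> \<in> space M. Z n \<omega> \<le> z - d / 4} + prob {\<omega> \<in> space M. d / 2 \<le> \<bar>R n \<omega>\<bar>}))"
        by (rule Limsup_mono)
      also have "\<dots> = ereal (?\<Phi> (z - d / 4) + 0)"
        using d(1) by (intro lim_imp_Limsup tendsto_ereal tendsto_add cdf_lim negligible) auto
      also have "\<dots> < ereal (1 - \<alpha>)"
        using cdf_std_normal_strict_mono[of "z - d / 4" z] d(1) z by simp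
      finally show "limsup (\<lambda>n. ereal (prob {\<omega> \<in> space M. Z n \<omega> + \<delta> n + R n \<omega> \<le> y n})) < ereal (1 - \<alpha>)" .
    qed
  next
    assume detect: ?detect
    show ?sep
    proof (rule ccontr)
      assume "\<not> ?sep"
      have freq: "\<exists>\<^sub>F n in sequentially. \<delta> n < d" if "0 < d" for d
      proof (rule ccontr)
        assume "\<not> ?thesis"
        then have "\<forall>\<^sub>F n in sequentially. d \<le> \<delta> n"
          by (simp add: not_frequently not_less)
        with that \<open>\<not> ?sep\<close> show False by blast
      qed
      let ?L = "limsup (\<lambda>n. ereal (prob {\<omega> \<in> space M. Z n \<omega> + \<delta> n + R n \<omega> \<le> 0}))"
      \<comment> \<open>if \<open>\<delta> n < d\<close> and \<open>\<bar>R n\<bar> < d\<close>, then \<open>Z n \<le> - 2 * d\<close> forces acceptance\<close>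
      have lower: "ereal (?\<Phi> (- 2 * d)) \<le> ?L" if d: "0 < d" for d
      proof -
        let ?g = "\<lambda>n. prob {\<omega> \<in> space M. Z n \<omega> \<le> - 2 * d} - prob {\<omega> \<in> space M. d \<le> \<bar>R n \<omega>\<bar>}"
        have g: "?g \<longlonglongrightarrow> ?\<Phi> (- 2 * d) - 0"
          by (intro tendsto_diff cdf_lim negligible d)
        have le: "?g n \<le> prob {\<omega> \<in> space M. Z n \<omega> + \<delta> n + R n \<omega> \<le> 0}" if "\<delta> n < d" for n
        proof -
          have "prob {\<omega> \<in> space M. Z n \<omega> \<le> - 2 * d}
             \<le> prob ({\<omega> \<in> space M. Z n \<omega> + \<delta> n + R n \<omega> \<le> 0} \<union> {\<omega> \<in> space M. d \<le> \<bar>R n \<omega>\<bar>})"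
            using that by (intro finite_measure_mono) (auto simp: abs_if split: if_splits)
          also have "\<dots> \<le> prob {\<omega> \<in> space M. Z n \<omega> + \<delta> n + R n \<omega> \<le> 0} + prob {\<omega> \<in> space M. d \<le> \<bar>R n \<omega>\<bar>}"
            by (intro measure_Un_le) auto
          finally show ?thesis by simp
        qed
        show ?thesis
        proof (rule ccontr)
          assume "\<not> ?thesis"
          then have "?L < ereal (?\<Phi> (- 2 * d))" by simp
          then obtain q where q: "?L < ereal q" "ereal q < ereal (?\<Phi> (- 2 * d))"
            using ereal_dense2 by blast
          have "\<forall>\<^sub>F n in sequentially. ereal (prob {\<omega> \<in> space M. Z n \<omega> + \<delta> n + R n \<omega> \<le> 0}) < ereal q"
            using q(1) by (rule Limsup_lessD)
          moreover have "\<forall>\<^sub>F n in sequentially. q < ?g n"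
            using order_tendstoD(1)[OF g, of q] q(2) by simp
          ultimately have "\<exists>\<^sub>F n in sequentially. False"
            by (intro frequently_rev_mp[OF freq[OF d]], eventually_elim) (use le in \<open>fastforce\<close>)
          then show False by simp
        qed
      qed
      have "((\<lambda>d. ?\<Phi> (- 2 * d)) \<longlongrightarrow> ?\<Phi> (- 2 * 0)) (at_right 0)"
        by (intro isCont_tendsto_compose[OF isCont_cdf_std_normal] tendsto_intros)
      then have "((\<lambda>d. ereal (?\<Phi> (- 2 * d))) \<longlongrightarrow> ereal (?\<Phi> 0)) (at_right 0)"
        by simp
      then have "ereal (?\<Phi> 0) \<le> ?L"
        by (rule tendsto_upperbound[OF _ eventually_at_right_less[THEN eventually_mono]]) (auto simp only: lower trivial_limit_at_right_real)
      moreover have "(\<lambda>n. prob {\<omega> \<in> space M. 0 < Z n \<omega>}) \<longlonglongrightarrow> 1 - ?\<Phi> 0"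
        unfolding compl by (intro tendsto_intros cdf_lim)
      then have "?L < ereal (1 - (1 - ?\<Phi> 0))"
        using detect[rule_format, of "1 - ?\<Phi> 0" "\<lambda>_. 0"] cdf_std_normal_bounds[of 0] by simp
      ultimately show False by simp
    qed
  }
qed

section \<open>Orders of magnitude of the coefficients\<close>

text \<open>
  The partial sums of the squares tend to \<open>rho \<kappa> n > rho \<kappa> n / 2\<close>. The set whose supremum defines
  \<open>k_idx \<kappa> n\<close> is therefore finite, and the supremum is its largest element; it is nonempty
  because the empty sum belongs to \<open>k = 1\<close>.
\<close>

lemma k_idx_half_sum:
  assumes sum: "summable (\<lambda>j. (\<kappa> n (Suc j))\<^sup>2)" and pos: "0 < rho \<kappa> n"
  shows "1 \<le> k_idx \<kappa> n" "rho \<kappa> n / 2 < (\<Sum>j = 1..k_idx \<kappa> n. (\<kappa> n j)\<^sup>2)"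
proof -
  let ?Q = "{k. 1 \<le> k \<and> (\<Sum>j=1..<k. (\<kappa> n j)\<^sup>2) \<le> rho \<kappa> n / 2}"
  have shift: "(\<Sum>j=1..<Suc m. (\<kappa> n j)\<^sup>2) = (\<Sum>j<m. (\<kappa> n (Suc j))\<^sup>2)" for m
    using sum.shift_bounds_Suc_ivl[of "\<lambda>j. (\<kappa> n j)\<^sup>2" 0 m] by (simp add: atLeast0LessThan)
  have "(\<lambda>m. \<Sum>j=1..<Suc m. (\<kappa> n j)\<^sup>2) \<longlonglongrightarrow> rho \<kappa> n"
    unfolding shift rho_def by (rule summable_LIMSEQ[OF sum])
  then have "(\<lambda>m. \<Sum>j=1..<m. (\<kappa> n j)\<^sup>2) \<longlonglongrightarrow> rho \<kappa> n"
    by (rule LIMSEQ_imp_Suc)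
  then have "\<forall>\<^sub>F m in sequentially. rho \<kappa> n / 2 < (\<Sum>j=1..<m. (\<kappa> n j)\<^sup>2)"
    using pos by (intro order_tendstoD(1)[of _ "rho \<kappa> n"]) auto
  then obtain N where "\<And>m. N \<le> m \<Longrightarrow> rho \<kappa> n / 2 < (\<Sum>j=1..<m. (\<kappa> n j)\<^sup>2)"
    by (auto simp: eventually_sequentially)
  then have "?Q \<subseteq> {..N}"
    by (auto simp: not_less[symmetric])
  then have fin: "finite ?Q" by (rule finite_subset) simp
  have one: "1 \<in> ?Q" using pos by simp
  then have k: "k_idx \<kappa> n = Max ?Q"
    unfolding k_idx_def Sup_nat_def by auto
  have "k_idx \<kappa> n \<in> ?Q"
    unfolding k using fin one by (intro Max_in) auto
  then show "1 \<le> k_idx \<kappa> n" by simp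
  have "Suc (k_idx \<kappa> n) \<notin> ?Q"
    using Max_ge[OF fin, of "Suc (k_idx \<kappa> n)"] unfolding k by auto
  then show "rho \<kappa> n / 2 < (\<Sum>j = 1..k_idx \<kappa> n. (\<kappa> n j)\<^sup>2)"
    by (simp add: atLeastLessThanSuc_atLeastAtMost not_le)
qed

text \<open>
  One of the two squares in a fourth power is bounded by its largest value, the one at index 1.
\<close>

lemma summable_fourth_powers:
  assumes sum: "summable (\<lambda>j. (\<kappa> n (Suc j))\<^sup>2)" and mono: "\<And>j. 1 \<le> j \<Longrightarrow> (\<kappa> n j)\<^sup>2 \<le> (\<kappa> n 1)\<^sup>2"
  shows "summable (\<lambda>j. \<kappa> n (Suc j) ^ 4)" "(\<Sum>j. \<kappa> n (Suc j) ^ 4) \<le> (\<kappa> n 1)\<^sup>2 * rho \<kappa> n"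
proof -
  have le: "\<kappa> n (Suc j) ^ 4 \<le> (\<kappa> n 1)\<^sup>2 * (\<kappa> n (Suc j))\<^sup>2" for j
    using mult_right_mono[OF mono[of "Suc j"], of "(\<kappa> n (Suc j))\<^sup>2"]
    by (simp add: power2_eq_square power4_eq_xxxx mult.assoc)
  have major: "summable (\<lambda>j. (\<kappa> n 1)\<^sup>2 * (\<kappa> n (Suc j))\<^sup>2)"
    by (intro summable_mult sum)
  show *: "summable (\<lambda>j. \<kappa> n (Suc j) ^ 4)"
    by (rule summable_comparison_test'[OF major]) (use le in auto)
  show "(\<Sum>j. \<kappa> n (Suc j) ^ 4) \<le> (\<kappa> n 1)\<^sup>2 * rho \<kappa> n"
    unfolding rho_def suminf_mult[OF sum, symmetric] by (intro suminf_le le * major)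
qed

text \<open>
  The coefficients up to \<open>k_idx \<kappa> n\<close> already carry half of \<open>rho \<kappa> n\<close>, and none of their squares is
  below \<open>kappa_sq \<kappa> n\<close>.
\<close>

lemma kappa_sq_rho_le_fourth_powers:
  assumes sum: "summable (\<lambda>j. (\<kappa> n (Suc j))\<^sup>2)" and pos: "0 < rho \<kappa> n"
    and mono: "\<And>i j. 1 \<le> i \<Longrightarrow> i \<le> j \<Longrightarrow> (\<kappa> n j)\<^sup>2 \<le> (\<kappa> n i)\<^sup>2"
  shows "kappa_sq \<kappa> n * (rho \<kappa> n / 2) \<le> (\<Sum>j. \<kappa> n (Suc j) ^ 4)"
proof -
  let ?k = "k_idx \<kappa> n"
  have "kappa_sq \<kappa> n * (rho \<kappa> n / 2) \<le> kappa_sq \<kappa> n * (\<Sum>j = 1..?k. (\<kappa> n j)\<^sup>2)"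
    using k_idx_half_sum(2)[OF sum pos] by (intro mult_left_mono) (auto simp: kappa_sq_def)
  also have "\<dots> = (\<Sum>j = 1..?k. (\<kappa> n ?k)\<^sup>2 * (\<kappa> n j)\<^sup>2)"
    by (simp add: kappa_sq_def sum_distrib_left)
  also have "\<dots> \<le> (\<Sum>j = 1..?k. (\<kappa> n j)\<^sup>2 * (\<kappa> n j)\<^sup>2)"
    by (intro sum_mono mult_right_mono mono) auto
  also have "\<dots> = (\<Sum>j<?k. \<kappa> n (Suc j) ^ 4)"
    by (simp add: sum.atLeast1_atMost_eq power2_eq_square power4_eq_xxxx mult.assoc)
  also have "\<dots> \<le> (\<Sum>j. \<kappa> n (Suc j) ^ 4)"
    using summable_fourth_powers(1)[of \<kappa> n, OF sum] mono[of 1] by (intro sum_le_suminf) auto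
  finally show ?thesis .
qed

text \<open>
  Let \<open>S\<close> be the sum of the fourth powers, \<open>p = n powr (- 2 * r)\<close> and \<open>q = 1 / n\<^sup>2\<close>. From
  \<open>kappa_sq \<kappa> n * (rho \<kappa> n / 2) \<le> S \<le> (\<kappa> n 1)\<^sup>2 * rho \<kappa> n\<close>, where \<open>S\<close> is of order \<open>q\<close> and
  \<open>rho \<kappa> n\<close> of order \<open>p\<close>, one reads off an upper bound for \<open>kappa_sq \<kappa> n\<close> and a lower bound for
  \<open>(\<kappa> n 1)\<^sup>2\<close>, both of order \<open>q / p = n powr (2 * r - 2)\<close>. Comparability of the two quantities
  turns these into two-sided bounds for each of them.
\<close>

lemma coefficient_orders:
  assumes "0 < \<sigma>" "A1 \<kappa>" "A2 \<sigma> \<kappa>" "A3 r \<kappa>" "A5 \<kappa>"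
  obtains L U :: real where "0 < L" "0 < U"
    "\<forall>\<^sub>F n in sequentially. L * real n powr (2 * r - 2) \<le> kappa_sq \<kappa> n
       \<and> (\<kappa> n 1)\<^sup>2 \<le> U * real n powr (2 * r - 2)
       \<and> L / (real n)\<^sup>2 \<le> (\<Sum>j. \<kappa> n (Suc j) ^ 4) \<and> (\<Sum>j. \<kappa> n (Suc j) ^ 4) \<le> U / (real n)\<^sup>2"
proof -
  obtain C1 C2 where C: "0 < C1" "0 < C2" "\<And>n. n \<ge> 1 \<Longrightarrow> C1 < A_coef \<sigma> \<kappa> n" "\<And>n. n \<ge> 1 \<Longrightarrow> A_coef \<sigma> \<kappa> n < C2"
    using \<open>A2 \<sigma> \<kappa>\<close> unfolding A2_def by blast
  obtain c1 c2 where c: "0 < c1" "0 < c2"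
      "\<And>n. n \<ge> 1 \<Longrightarrow> c1 * real n powr (- 2 * r) \<le> rho \<kappa> n"
      "\<And>n. n \<ge> 1 \<Longrightarrow> rho \<kappa> n \<le> c2 * real n powr (- 2 * r)"
      "\<And>n. n \<ge> 1 \<Longrightarrow> summable (\<lambda>j. (\<kappa> n (Suc j))\<^sup>2)"
    using \<open>A3 r \<kappa>\<close> unfolding A3_def by blast
  obtain b B where B: "0 < b" "0 < B"
      "\<forall>\<^sub>F n in sequentially. b \<le> (\<kappa> n 1)\<^sup>2 / kappa_sq \<kappa> n \<and> (\<kappa> n 1)\<^sup>2 / kappa_sq \<kappa> n \<le> B"
    using \<open>A5 \<kappa>\<close> unfolding A5_def same_order_def by blast
  define L1 where "L1 = \<sigma> ^ 4 * C1"
  define U1 where "U1 = \<sigma> ^ 4 * C2"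
  define L where "L = min L1 (L1 / (B * c2))"
  define U where "U = max U1 (B * (2 * U1 / c1))"
  have pos: "0 < L1" "0 < U1" "0 < L" "0 < U"
    using \<open>0 < \<sigma>\<close> C c B by (auto simp: L1_def U1_def L_def U_def less_max_iff_disj)
  show thesis
  proof (rule that[OF pos(3,4)])
    show "\<forall>\<^sub>F n in sequentially. L * real n powr (2 * r - 2) \<le> kappa_sq \<kappa> n
       \<and> (\<kappa> n 1)\<^sup>2 \<le> U * real n powr (2 * r - 2)
       \<and> L / (real n)\<^sup>2 \<le> (\<Sum>j. \<kappa> n (Suc j) ^ 4) \<and> (\<Sum>j. \<kappa> n (Suc j) ^ 4) \<le> U / (real n)\<^sup>2"
      using B(3) eventually_ge_at_top[of 1]
    proof eventually_elim
      case (elim n)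
      let ?S = "\<Sum>j. \<kappa> n (Suc j) ^ 4" and ?K = "kappa_sq \<kappa> n"
      have mono: "(\<kappa> n j)\<^sup>2 \<le> (\<kappa> n i)\<^sup>2" if "1 \<le> i" "i \<le> j" for i j
        using \<open>A1 \<kappa>\<close> elim that unfolding A1_def by blast
      define p where "p = real n powr (- 2 * r)"
      define q where "q = 1 / (real n)\<^sup>2"
      have n: "0 < real n" and p: "0 < p" and q: "0 < q"
        using elim by (auto simp: p_def q_def)
      have pq: "real n powr (2 * r - 2) = q / p"
      proof -
        have "real n powr (2 * r - 2) = real n powr (2 * r) / real n powr 2"
          by (rule powr_diff)
        also have "real n powr 2 = (real n)\<^sup>2"
          using n powr_numeral[of "real n" num.One] by (simp add: powr_numeral)
        finally show ?thesis
          by (simp add: p_def q_def powr_minus field_simps)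
      qed
      have A: "A_coef \<sigma> \<kappa> n = ?S / (\<sigma> ^ 4 * q)"
        by (simp add: A_coef_def q_def)
      have S: "L1 * q \<le> ?S" "?S \<le> U1 * q"
        using C(3,4)[OF elim(2)] \<open>0 < \<sigma>\<close> q unfolding A by (simp_all add: L1_def U1_def field_simps)
      have rho: "c1 * p \<le> rho \<kappa> n" "rho \<kappa> n \<le> c2 * p" "0 < rho \<kappa> n"
        using c(3,4)[OF elim(2)] mult_pos_pos[OF c(1) p] by (auto simp: p_def)
      have K: "0 < ?K"
        using elim(1) B(1) by (cases "?K = 0") (auto simp: kappa_sq_def less_le)
      have k1: "(\<kappa> n 1)\<^sup>2 \<le> B * ?K"
        using elim(1) K by (simp add: field_simps)
      have "?K * (c1 * p / 2) \<le> ?K * (rho \<kappa> n / 2)"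
        using rho K by (intro mult_left_mono) auto
      also have "\<dots> \<le> U1 * q"
        using kappa_sq_rho_le_fourth_powers[OF c(5)[OF elim(2)] rho(3) mono] S by simp
      finally have "?K \<le> 2 * U1 / c1 * (q / p)"
        using c(1) p by (simp add: field_simps)
      then have "B * ?K \<le> B * (2 * U1 / c1 * (q / p))"
        using B(2) by (intro mult_left_mono) auto
      also have "\<dots> = (B * (2 * U1 / c1)) * (q / p)"
        by (simp only: mult.assoc)
      also have "\<dots> \<le> U * (q / p)"
        using p q by (intro mult_right_mono) (auto simp: U_def)
      finally have upper: "(\<kappa> n 1)\<^sup>2 \<le> U * (q / p)"
        using k1 by simp
      have "L1 * q \<le> (\<kappa> n 1)\<^sup>2 * rho \<kappa> n"
        using S summable_fourth_powers(2)[of \<kappa> n, OF c(5)[OF elim(2)] mono] by simp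
      also have "\<dots> \<le> (B * ?K) * (c2 * p)"
        using k1 rho K B(2) by (intro mult_mono) auto
      finally have "L1 / (B * c2) * (q / p) \<le> ?K"
        using B(2) c(2) p by (simp add: field_simps)
      moreover have "L * (q / p) \<le> L1 / (B * c2) * (q / p)"
        using p q by (intro mult_right_mono) (auto simp: L_def)
      ultimately have lower: "L * (q / p) \<le> ?K" by simp
      have "L * q \<le> L1 * q" "U1 * q \<le> U * q"
        using q by (auto simp: L_def U_def)
      then have "L / (real n)\<^sup>2 \<le> ?S" "?S \<le> U / (real n)\<^sup>2"
        using S by (auto simp: q_def)
      then show ?case
        using upper lower by (simp add: pq)
    qed
  qed
qed

section \<open>Bessel inequality\<close>

lemma integrable_L2_product:
  assumes "g \<in> L2_01" "h \<in> L2_01"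
  shows "integrable M01 (\<lambda>t. g t * h t)"
proof (rule Bochner_Integration.integrable_bound)
  show "integrable M01 (\<lambda>t. (g t)\<^sup>2 + (h t)\<^sup>2)"
    using assms by (intro Bochner_Integration.integrable_add) (auto simp: L2_01_def)
  show "(\<lambda>t. g t * h t) \<in> borel_measurable M01"
    using assms by (intro borel_measurable_times) (auto simp: L2_01_def)
  have "\<bar>a * b\<bar> \<le> a\<^sup>2 + b\<^sup>2" for a b :: real
  proof -
    have "2 * (\<bar>a\<bar> * \<bar>b\<bar>) \<le> a\<^sup>2 + b\<^sup>2"
      using sum_squares_bound[of "\<bar>a\<bar>" "\<bar>b\<bar>"] by simp
    moreover have "0 \<le> \<bar>a\<bar> * \<bar>b\<bar>" by simp
    ultimately show ?thesis unfolding abs_mult by linarith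
  qed
  then show "AE t in M01. norm (g t * h t) \<le> norm ((g t)\<^sup>2 + (h t)\<^sup>2)"
    by (intro AE_I2) simp
qed

lemma L2_inner_sum_right:
  assumes "g \<in> L2_01" "\<And>j. j \<in> A \<Longrightarrow> e j \<in> L2_01" "finite A"
  shows "integrable M01 (\<lambda>t. g t * (\<Sum>j\<in>A. c j * e j t))"
    "L2_inner g (\<lambda>t. \<Sum>j\<in>A. c j * e j t) = (\<Sum>j\<in>A. c j * L2_inner g (e j))"
proof -
  have eq: "g t * (\<Sum>j\<in>A. c j * e j t) = (\<Sum>j\<in>A. c j * (g t * e j t))" for t
    by (simp add: sum_distrib_left mult_ac)
  show "integrable M01 (\<lambda>t. g t * (\<Sum>j\<in>A. c j * e j t))"
    unfolding eq using assms
    by (intro Bochner_Integration.integrable_sum integrable_mult_right integrable_L2_product)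
  show "L2_inner g (\<lambda>t. \<Sum>j\<in>A. c j * e j t) = (\<Sum>j\<in>A. c j * L2_inner g (e j))"
    unfolding L2_inner_def eq using assms
    by (subst Bochner_Integration.integral_sum) (auto intro!: integrable_L2_product)
qed

text \<open>
  With \<open>h\<close> the projection of \<open>g\<close> to the span of the family, the inner products \<open>\<langle>h, h\<rangle>\<close> and \<open>\<langle>g, h\<rangle>\<close>
  both equal the sum of the squared coefficients; now expand \<open>0 \<le> \<parallel>g - h\<parallel>\<^sup>2\<close>.
\<close>

lemma bessel_inequality_finite:
  assumes e: "orthonormal_on A e" and g: "g \<in> L2_01" and fin: "finite A"
  shows "(\<Sum>j\<in>A. (L2_inner g (e j))\<^sup>2) \<le> L2_inner g g"
proof -
  define c where "c j = L2_inner g (e j)" for j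
  define h where "h t = (\<Sum>j\<in>A. c j * e j t)" for t
  have eL2: "e j \<in> L2_01" if "j \<in> A" for j
    using e that by (auto simp: orthonormal_on_def)
  have comm: "L2_inner u v = L2_inner v u" for u v
    by (simp add: L2_inner_def mult.commute)
  have int: "integrable M01 (\<lambda>t. g t * g t)" "integrable M01 (\<lambda>t. g t * h t)"
    using integrable_L2_product[OF g g] L2_inner_sum_right(1)[where g = g and e = e and c = c and A = A, OF g eL2 fin] by (auto simp: h_def)
  have he: "integrable M01 (\<lambda>t. h t * e j t)" "L2_inner h (e j) = c j" if "j \<in> A" for j
  proof -
    show "integrable M01 (\<lambda>t. h t * e j t)"
      using L2_inner_sum_right(1)[where g = "e j" and e = e and c = c and A = A, OF eL2[OF that] eL2 fin] by (simp add: h_def mult.commute)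
    have "L2_inner h (e j) = (\<Sum>i\<in>A. c i * L2_inner (e j) (e i))"
      using L2_inner_sum_right(2)[where g = "e j" and e = e and c = c and A = A, OF eL2[OF that] eL2 fin] by (simp add: h_def[abs_def] comm)
    also have "\<dots> = (\<Sum>i\<in>A. if i = j then c i else 0)"
      using e that by (intro sum.cong) (auto simp: orthonormal_on_def)
    also have "\<dots> = c j"
      using fin that by simp
    finally show "L2_inner h (e j) = c j" .
  qed
  have hh: "h t * h t = (\<Sum>j\<in>A. c j * (h t * e j t))" for t
    by (subst (2) h_def) (simp add: sum_distrib_left mult_ac)
  have int_h: "integrable M01 (\<lambda>t. h t * h t)"
    unfolding hh by (intro Bochner_Integration.integrable_sum integrable_mult_right he)
  have "L2_inner h h = (\<Sum>j\<in>A. c j * L2_inner h (e j))"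
    unfolding L2_inner_def hh using he
    by (subst Bochner_Integration.integral_sum) (auto simp: L2_inner_def)
  then have inner_h: "L2_inner h h = (\<Sum>j\<in>A. (c j)\<^sup>2)"
    by (simp add: he power2_eq_square)
  have inner_gh: "L2_inner g h = (\<Sum>j\<in>A. (c j)\<^sup>2)"
    using L2_inner_sum_right(2)[where g = g and e = e and c = c and A = A, OF g eL2 fin] by (simp add: h_def[abs_def] c_def power2_eq_square)
  have "0 \<le> (LINT t|M01. (g t - h t)\<^sup>2)"
    by simp
  also have "\<dots> = (LINT t|M01. g t * g t + h t * h t - 2 * (g t * h t))"
    by (intro Bochner_Integration.integral_cong refl) (simp add: power2_eq_square algebra_simps)
  also have "\<dots> = L2_inner g g + L2_inner h h - 2 * L2_inner g h"
    unfolding L2_inner_def using int int_h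
    by (subst Bochner_Integration.integral_diff) auto
  finally show ?thesis
    using inner_h inner_gh by (simp add: c_def)
qed

lemma bessel_inequality:
  assumes e: "orthonormal_on {1..} \<phi>" and g: "g \<in> L2_01"
  shows "summable (\<lambda>j. (L2_inner g (\<phi> (Suc j)))\<^sup>2)"
    "(\<Sum>j. (L2_inner g (\<phi> (Suc j)))\<^sup>2) \<le> (L2_norm g)\<^sup>2"
proof -
  have norm: "(L2_norm g)\<^sup>2 = L2_inner g g"
    unfolding L2_norm_def L2_inner_def by (intro real_sqrt_pow2 integral_nonneg_AE AE_I2) simp
  have part: "(\<Sum>j<N. (L2_inner g (\<phi> (Suc j)))\<^sup>2) \<le> L2_inner g g" for N
  proof -
    have "orthonormal_on {..<N} (\<lambda>j. \<phi> (Suc j))"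
      using e by (auto simp: orthonormal_on_def)
    then show ?thesis by (rule bessel_inequality_finite[OF _ g]) simp
  qed
  show "summable (\<lambda>j. (L2_inner g (\<phi> (Suc j)))\<^sup>2)"
    by (rule bounded_imp_summable[of _ "L2_inner g g"])
       (use part[of "Suc _"] in \<open>auto simp: lessThan_Suc_atMost\<close>)
  then show "(\<Sum>j. (L2_inner g (\<phi> (Suc j)))\<^sup>2) \<le> (L2_norm g)\<^sup>2"
    unfolding norm by (rule suminf_le_const) (rule part)
qed

section \<open>Energy of the signal in the leading coordinates\<close>

text \<open>
  The weights are at most \<open>(\<kappa> n 1)\<^sup>2\<close>, and they are at least a constant times \<open>kappa_sq \<kappa> n\<close> on the
  coordinates below any fixed multiple of \<open>k_idx \<kappa> n\<close>. Both bounds have the order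
  \<open>n powr (2 * r - 2)\<close>, so on these coordinates the weighted energy of order \<open>1 / n\<^sup>2\<close> corresponds
  to the plain energy of order \<open>n powr (- 2 * r)\<close>. Beyond the multiple \<open>c2\<close>, decay of the weights
  bounds the contribution to the weighted energy by a constant times \<open>c2 powr (- l) / n\<^sup>2\<close> with
  \<open>l > 1\<close>. For large \<open>c2\<close> this is at most half of a given lower bound \<open>d / n\<^sup>2\<close>, and the leading
  coordinates must account for the other half.
\<close>

lemma weighted_sum_separated_iff:
  fixes \<theta> :: "nat \<Rightarrow> nat \<Rightarrow> real" and L U B :: real
  assumes A1: "A1 \<kappa>" and A4: "A4 \<kappa>" and A5: "A5 \<kappa>" and pos: "0 < L" "0 < U" "0 \<le> B"
    and k1: "\<And>n. n \<ge> 1 \<Longrightarrow> 1 \<le> k_idx \<kappa> n"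
    and orders: "\<forall>\<^sub>F n in sequentially. L * real n powr (2 * r - 2) \<le> kappa_sq \<kappa> n
       \<and> (\<kappa> n 1)\<^sup>2 \<le> U * real n powr (2 * r - 2)"
    and summable: "\<And>n. n \<ge> 1 \<Longrightarrow> summable (\<lambda>j. (\<theta> n (Suc j))\<^sup>2)"
    and energy: "\<And>n. n \<ge> 1 \<Longrightarrow> (\<Sum>j. (\<theta> n (Suc j))\<^sup>2) \<le> B * real n powr (- 2 * r)"
  shows "(\<exists>d>0. \<forall>\<^sub>F n in sequentially. d \<le> (real n)\<^sup>2 * (\<Sum>j. (\<kappa> n (Suc j))\<^sup>2 * (\<theta> n (Suc j))\<^sup>2)) \<longleftrightarrow>
    (\<exists>c1>0. \<exists>c2>0. \<exists>n0. \<forall>n>n0.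
       (\<Sum>j | 1 \<le> j \<and> real j < c2 * real (k_idx \<kappa> n). (\<theta> n j)\<^sup>2) > c1 * real n powr (- 2 * r))"
    (is "?sep \<longleftrightarrow> ?low")
proof -
  let ?J = "\<lambda>c n. {j. 1 \<le> j \<and> real j < c * real (k_idx \<kappa> n)}"
  let ?m = "\<lambda>c n. nat \<lfloor>c * real (k_idx \<kappa> n)\<rfloor>"
  let ?D = "\<lambda>n. \<Sum>j. (\<kappa> n (Suc j))\<^sup>2 * (\<theta> n (Suc j))\<^sup>2"
  have mono: "(\<kappa> n j)\<^sup>2 \<le> (\<kappa> n i)\<^sup>2" if "1 \<le> n" "1 \<le> i" "i \<le> j" for n i j
    using A1 that unfolding A1_def by blast
  have J: "?J c n \<subseteq> {1..?m c n}" for c n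
    by (auto simp: le_nat_floor)
  then have fin: "finite (?J c n)" for c n
    by (rule finite_subset) simp
  have sumD: "summable (\<lambda>j. (\<kappa> n (Suc j))\<^sup>2 * (\<theta> n (Suc j))\<^sup>2)" if "1 \<le> n" for n
    by (rule summable_comparison_test'[OF summable_mult[OF summable[OF that], of "(\<kappa> n 1)\<^sup>2"]])
       (use mono[OF that, of 1] in \<open>auto intro!: mult_right_mono\<close>)
  have pq: "real n powr (2 * r - 2) = 1 / ((real n)\<^sup>2 * real n powr (- 2 * r))" "0 < real n powr (- 2 * r)" if "1 \<le> n" for n
    using that by (simp_all add: powr_diff powr_minus powr_numeral field_simps)
  show ?thesis
  proof
    assume ?low
    then obtain c1 c2 n0 where c: "0 < c1" "0 < c2"
      "\<And>n. n0 < n \<Longrightarrow> c1 * real n powr (- 2 * r) < (\<Sum>j\<in>?J c2 n. (\<theta> n j)\<^sup>2)"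
      by blast
    \<comment> \<open>the lower bound for the weights concerns multiples of the index that exceed 1\<close>
    define c' where "c' = max c2 2"
    obtain C5 where C5: "0 < C5" "\<And>n. 1 \<le> n \<Longrightarrow> C5 * kappa_sq \<kappa> n \<le> (\<kappa> n (?m c' n))\<^sup>2"
      using A5 unfolding A5_def c'_def by (metis less_max_iff_disj one_less_numeral_iff semiring_norm(76))
    have "\<forall>\<^sub>F n in sequentially. C5 * L * c1 \<le> (real n)\<^sup>2 * ?D n"
      using orders eventually_gt_at_top[of n0] eventually_ge_at_top[of 1]
    proof eventually_elim
      case (elim n)
      let ?p = "real n powr (- 2 * r)"
      note p = pq[OF elim(3)]
      have "C5 * (L * (1 / ((real n)\<^sup>2 * ?p))) * (c1 * ?p) \<le> (\<kappa> n (?m c' n))\<^sup>2 * (\<Sum>j\<in>?J c2 n. (\<theta> n j)\<^sup>2)"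
      proof (rule mult_mono)
        have "C5 * (L * (1 / ((real n)\<^sup>2 * ?p))) \<le> C5 * kappa_sq \<kappa> n"
          using elim(1) C5(1) unfolding p(1) by (intro mult_left_mono) auto
        also have "\<dots> \<le> (\<kappa> n (?m c' n))\<^sup>2"
          by (rule C5(2)[OF elim(3)])
        finally show "C5 * (L * (1 / ((real n)\<^sup>2 * ?p))) \<le> (\<kappa> n (?m c' n))\<^sup>2" .
      qed (use c elim p in \<open>auto intro: less_imp_le\<close>)
      also have "\<dots> = (\<Sum>j\<in>?J c2 n. (\<kappa> n (?m c' n))\<^sup>2 * (\<theta> n j)\<^sup>2)"
        by (simp add: sum_distrib_left)
      also have "\<dots> \<le> (\<Sum>j\<in>?J c2 n. (\<kappa> n j)\<^sup>2 * (\<theta> n j)\<^sup>2)"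
      proof (intro sum_mono mult_right_mono mono elim)
        fix j assume "j \<in> ?J c2 n"
        then have "real j \<le> c' * real (k_idx \<kappa> n)"
          using mult_right_mono[of c2 c' "real (k_idx \<kappa> n)"] by (auto simp: c'_def)
        then show "j \<le> ?m c' n" by (rule le_nat_floor)
      qed auto
      also have "\<dots> \<le> (\<Sum>j = 1..?m c2 n. (\<kappa> n j)\<^sup>2 * (\<theta> n j)\<^sup>2)"
        by (rule sum_mono2[OF _ J]) auto
      also have "\<dots> = (\<Sum>j<?m c2 n. (\<kappa> n (Suc j))\<^sup>2 * (\<theta> n (Suc j))\<^sup>2)"
        by (simp add: sum.atLeast1_atMost_eq)
      also have "\<dots> \<le> ?D n"
        by (intro sum_le_suminf sumD elim) auto
      finally show ?case
        using elim(3) p(2) by (simp add: field_simps)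
    qed
    moreover have "0 < C5 * L * c1" using C5 pos c by simp
    ultimately show ?sep by blast
  next
    assume ?sep
    then obtain d where d: "0 < d" "\<forall>\<^sub>F n in sequentially. d \<le> (real n)\<^sup>2 * ?D n" by blast
    obtain C4 l where C4: "1 < l" "\<And>\<delta> n. 0 < \<delta> \<Longrightarrow> 1 \<le> n \<Longrightarrow>
        (\<kappa> n (?m (1 + \<delta>) n))\<^sup>2 < C4 * (1 + \<delta>) powr (- l) * kappa_sq \<kappa> n"
      using A4 unfolding A4_def by blast
    \<comment> \<open>large enough for the coordinates beyond the multiple \<open>1 + \<delta>\<close> to contribute at most \<open>d / 2\<close>\<close>
    define \<delta> where "\<delta> = 1 + 2 * \<bar>C4\<bar> * U * B / d"
    have \<delta>: "0 < \<delta>" using pos d by (simp add: \<delta>_def add_pos_nonneg)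
    have tail: "C4 * (1 + \<delta>) powr (- l) * U * B \<le> d / 2"
    proof -
      have "(1 + \<delta>) powr (- l) \<le> (1 + \<delta>) powr (- 1)"
        using \<delta> C4(1) by (intro powr_mono) auto
      then have "C4 * (1 + \<delta>) powr (- l) \<le> \<bar>C4\<bar> * (1 / (1 + \<delta>))"
        using \<delta> by (intro mult_mono) (auto simp: powr_minus field_simps)
      then have "C4 * (1 + \<delta>) powr (- l) * (U * B) \<le> \<bar>C4\<bar> * (1 / (1 + \<delta>)) * (U * B)"
        using pos by (intro mult_right_mono) auto
      also have "\<dots> \<le> d / 2"
      proof -
        have "2 * \<bar>C4\<bar> * U * B = (\<delta> - 1) * d"
          using d by (simp add: \<delta>_def)
        also have "\<dots> \<le> (1 + \<delta>) * d" using d by (intro mult_right_mono) auto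
        finally show ?thesis using \<delta> by (simp add: field_simps)
      qed
      finally show ?thesis by (simp add: mult.assoc)
    qed
    have "\<forall>\<^sub>F n in sequentially. d / (4 * U) * real n powr (- 2 * r) < (\<Sum>j\<in>?J (1 + \<delta>) n. (\<theta> n j)\<^sup>2)"
      using orders d(2) eventually_ge_at_top[of 1]
    proof eventually_elim
      case (elim n)
      let ?p = "real n powr (- 2 * r)" and ?m1 = "?m (1 + \<delta>) n" and ?J1 = "?J (1 + \<delta>) n"
      note p = pq[OF elim(3)]
      have k: "1 \<le> k_idx \<kappa> n" by (rule k1[OF elim(3)])
      have m1: "1 \<le> ?m1"
        using k \<delta> mult_mono[of 1 "1 + \<delta>" 1 "real (k_idx \<kappa> n)"] by (auto simp: le_nat_iff le_floor_iff)
      have D: "?D n \<le> (\<kappa> n 1)\<^sup>2 * (\<Sum>j\<in>?J1. (\<theta> n j)\<^sup>2) + (\<kappa> n ?m1)\<^sup>2 * (\<Sum>j. (\<theta> n (Suc j))\<^sup>2)"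
      proof (rule suminf_le_const[OF sumD[OF elim(3)]])
        fix N
        let ?g = "\<lambda>j. (\<kappa> n j)\<^sup>2 * (\<theta> n j)\<^sup>2"
        have "(\<Sum>j<N. ?g (Suc j)) = (\<Sum>j\<in>{1..N}. ?g j)"
          by (simp add: sum.atLeast1_atMost_eq)
        also have "\<dots> = (\<Sum>j\<in>{1..N} \<inter> ?J1. ?g j) + (\<Sum>j\<in>{1..N} - ?J1. ?g j)"
          by (rule sum.Int_Diff) simp
        finally have split: "(\<Sum>j<N. ?g (Suc j)) = (\<Sum>j\<in>{1..N} \<inter> ?J1. ?g j) + (\<Sum>j\<in>{1..N} - ?J1. ?g j)" .
        have "(\<Sum>j\<in>{1..N} \<inter> ?J1. ?g j) \<le> (\<Sum>j\<in>?J1. ?g j)"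
          by (rule sum_mono2[OF fin]) auto
        also have "\<dots> \<le> (\<Sum>j\<in>?J1. (\<kappa> n 1)\<^sup>2 * (\<theta> n j)\<^sup>2)"
          by (intro sum_mono mult_right_mono mono[OF elim(3)]) auto
        finally have head: "(\<Sum>j\<in>{1..N} \<inter> ?J1. ?g j) \<le> (\<kappa> n 1)\<^sup>2 * (\<Sum>j\<in>?J1. (\<theta> n j)\<^sup>2)"
          by (simp add: sum_distrib_left)
        have "(\<Sum>j\<in>{1..N} - ?J1. ?g j) \<le> (\<Sum>j\<in>{1..N} - ?J1. (\<kappa> n ?m1)\<^sup>2 * (\<theta> n j)\<^sup>2)"
        proof (intro sum_mono mult_right_mono mono[OF elim(3)] m1)
          fix j assume "j \<in> {1..N} - ?J1"
          then have "(1 + \<delta>) * real (k_idx \<kappa> n) \<le> real j" by auto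
          then show "?m1 \<le> j" by linarith
        qed auto
        also have "\<dots> \<le> (\<Sum>j\<in>{1..N}. (\<kappa> n ?m1)\<^sup>2 * (\<theta> n j)\<^sup>2)"
          by (rule sum_mono2) auto
        also have "\<dots> = (\<kappa> n ?m1)\<^sup>2 * (\<Sum>j<N. (\<theta> n (Suc j))\<^sup>2)"
          by (simp add: sum.atLeast1_atMost_eq sum_distrib_left)
        also have "\<dots> \<le> (\<kappa> n ?m1)\<^sup>2 * (\<Sum>j. (\<theta> n (Suc j))\<^sup>2)"
          by (intro mult_left_mono sum_le_suminf summable elim) auto
        finally show "(\<Sum>j<N. ?g (Suc j)) \<le> (\<kappa> n 1)\<^sup>2 * (\<Sum>j\<in>?J1. (\<theta> n j)\<^sup>2)
            + (\<kappa> n ?m1)\<^sup>2 * (\<Sum>j. (\<theta> n (Suc j))\<^sup>2)"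
          using split head by linarith
      qed
      have Kk: "kappa_sq \<kappa> n \<le> U * (1 / ((real n)\<^sup>2 * ?p))"
        using mono[OF elim(3) _ k] elim(1) unfolding kappa_sq_def p(1) by (auto intro: order_trans)
      have C4_nonneg: "0 \<le> C4 * (1 + \<delta>) powr (- l)"
      proof -
        have "0 < C4 * (1 + \<delta>) powr (- l) * kappa_sq \<kappa> n"
          by (rule le_less_trans[OF zero_le_power2 C4(2)[OF \<delta> elim(3)]])
        then show ?thesis
          using zero_le_power2[of "\<kappa> n (k_idx \<kappa> n)"] by (auto simp: kappa_sq_def zero_less_mult_iff)
      qed
      have "(\<kappa> n ?m1)\<^sup>2 * (\<Sum>j. (\<theta> n (Suc j))\<^sup>2)
          \<le> (C4 * (1 + \<delta>) powr (- l) * (U * (1 / ((real n)\<^sup>2 * ?p)))) * (B * ?p)"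
      proof (rule mult_mono)
        show "(\<kappa> n ?m1)\<^sup>2 \<le> C4 * (1 + \<delta>) powr (- l) * (U * (1 / ((real n)\<^sup>2 * ?p)))"
          using C4(2)[OF \<delta> elim(3)] mult_left_mono[OF Kk C4_nonneg] by linarith
      qed (use energy[OF elim(3)] C4_nonneg pos in \<open>auto intro!: mult_nonneg_nonneg suminf_nonneg summable elim\<close>)
      also have "\<dots> = C4 * (1 + \<delta>) powr (- l) * U * B / (real n)\<^sup>2"
        using p(2) elim(3) by (simp add: field_simps)
      also have "\<dots> \<le> d / 2 / (real n)\<^sup>2"
        by (intro divide_right_mono tail) simp
      finally have "(real n)\<^sup>2 * ((\<kappa> n ?m1)\<^sup>2 * (\<Sum>j. (\<theta> n (Suc j))\<^sup>2)) \<le> d / 2"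
        using elim(3) by (simp add: field_simps)
      moreover have "d \<le> (real n)\<^sup>2 * ((\<kappa> n 1)\<^sup>2 * (\<Sum>j\<in>?J1. (\<theta> n j)\<^sup>2)) + (real n)\<^sup>2 * ((\<kappa> n ?m1)\<^sup>2 * (\<Sum>j. (\<theta> n (Suc j))\<^sup>2))"
        using elim(2) mult_left_mono[OF D, of "(real n)\<^sup>2"] by (simp add: distrib_left)
      moreover have "(real n)\<^sup>2 * ((\<kappa> n 1)\<^sup>2 * (\<Sum>j\<in>?J1. (\<theta> n j)\<^sup>2))
          \<le> (real n)\<^sup>2 * (U * (1 / ((real n)\<^sup>2 * ?p)) * (\<Sum>j\<in>?J1. (\<theta> n j)\<^sup>2))"
        using elim(1) unfolding p(1) by (intro mult_left_mono mult_right_mono sum_nonneg) auto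
      moreover have "(real n)\<^sup>2 * (U * (1 / ((real n)\<^sup>2 * ?p)) * (\<Sum>j\<in>?J1. (\<theta> n j)\<^sup>2))
          = U / ?p * (\<Sum>j\<in>?J1. (\<theta> n j)\<^sup>2)"
        using elim(3) by simp
      ultimately have "d / 2 \<le> U / ?p * (\<Sum>j\<in>?J1. (\<theta> n j)\<^sup>2)" by linarith
      moreover have "d / 4 < d / 2" using d by simp
      ultimately have "d / 4 < U / ?p * (\<Sum>j\<in>?J1. (\<theta> n j)\<^sup>2)" by linarith
      then show ?case
        using p(2) pos by (simp add: field_simps)
    qed
    then obtain n0 where "\<And>n. n0 < n \<Longrightarrow> d / (4 * U) * real n powr (- 2 * r) < (\<Sum>j\<in>?J (1 + \<delta>) n. (\<theta> n j)\<^sup>2)"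
      unfolding eventually_sequentially by (meson less_imp_le)
    moreover have "0 < d / (4 * U)" using d pos by simp
    ultimately show ?low
      using \<delta> by (intro exI[of _ "d / (4 * U)"] exI[of _ "1 + \<delta>"] conjI exI[of _ n0]) auto
  qed
qed

section \<open>Consistency of the quadratic tests\<close>

text \<open>
  Expanding the square gives a pure noise term, a deterministic term and a cross term. Each of the
  three series converges separately, the cross term because \<open>\<bar>\<theta> j * \<xi> j \<omega>\<bar> \<le> (\<theta> j)\<^sup>2 + (\<xi> j \<omega>)\<^sup>2\<close>. The common
  factor is chosen so that the noise term is standardised when \<open>v\<^sup>2 = 2 * (\<Sum>j. (w j)\<^sup>2)\<close>.
\<close>

lemma (in gaussian_sequence) quadratic_statistic_decomposition:
  fixes w \<theta> :: "nat \<Rightarrow> real" and s v :: real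
  assumes w: "\<And>j. 0 \<le> w j" "summable w" and \<theta>: "summable (\<lambda>j. (\<theta> j)\<^sup>2)" and nz: "s \<noteq> 0" "v \<noteq> 0"
  shows "AE \<omega> in M. summable (\<lambda>j. 2 / (s * v) * (w j * \<theta> j) * \<xi> j \<omega>) \<and>
     (\<Sum>j. w j * (\<theta> j + s * \<xi> j \<omega>)\<^sup>2) - s\<^sup>2 * (\<Sum>j. w j)
     = s\<^sup>2 * v * ((\<Sum>j. w j / v * ((\<xi> j \<omega>)\<^sup>2 - 1)) + (\<Sum>j. w j * (\<theta> j)\<^sup>2) / (s\<^sup>2 * v)
         + (\<Sum>j. 2 / (s * v) * (w j * \<theta> j) * \<xi> j \<omega>))"
  using AE_summable_weighted_squares[OF w]
proof eventually_elim
  case (elim \<omega>)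
  have w_le: "w j \<le> suminf w" for j
    using sum_le_suminf[OF w(2), of "{j}"] w(1) by simp
  have sq: "summable (\<lambda>j. w j * (\<theta> j)\<^sup>2)"
    by (rule summable_comparison_test'[OF summable_mult[OF \<theta>, of "suminf w"]])
       (use w w_le in \<open>auto intro!: mult_right_mono\<close>)
  have cross: "summable (\<lambda>j. w j * \<theta> j * \<xi> j \<omega>)"
  proof (rule summable_comparison_test'[OF summable_add[OF sq elim]])
    fix j
    have "2 * (\<bar>\<theta> j\<bar> * \<bar>\<xi> j \<omega>\<bar>) \<le> (\<theta> j)\<^sup>2 + (\<xi> j \<omega>)\<^sup>2"
      using sum_squares_bound[of "\<bar>\<theta> j\<bar>" "\<bar>\<xi> j \<omega>\<bar>"] by simp
    moreover have "0 \<le> \<bar>\<theta> j\<bar> * \<bar>\<xi> j \<omega>\<bar>" by simp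
    ultimately have "\<bar>\<theta> j\<bar> * \<bar>\<xi> j \<omega>\<bar> \<le> (\<theta> j)\<^sup>2 + (\<xi> j \<omega>)\<^sup>2" by linarith
    then have "w j * (\<bar>\<theta> j\<bar> * \<bar>\<xi> j \<omega>\<bar>) \<le> w j * ((\<theta> j)\<^sup>2 + (\<xi> j \<omega>)\<^sup>2)"
      using w(1) by (intro mult_left_mono)
    then show "norm (w j * \<theta> j * \<xi> j \<omega>) \<le> w j * (\<theta> j)\<^sup>2 + w j * (\<xi> j \<omega>)\<^sup>2"
      using w(1)[of j] by (simp add: abs_mult distrib_left mult.assoc)
  qed
  have chi: "summable (\<lambda>j. w j * ((\<xi> j \<omega>)\<^sup>2 - 1))"
    using summable_diff[OF elim w(2)] by (simp add: right_diff_distrib)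
  have "(\<lambda>j. w j * (\<theta> j)\<^sup>2 + 2 * s * (w j * \<theta> j * \<xi> j \<omega>) + (s\<^sup>2 * (w j * ((\<xi> j \<omega>)\<^sup>2 - 1)) + s\<^sup>2 * w j))
    sums ((\<Sum>j. w j * (\<theta> j)\<^sup>2) + 2 * s * (\<Sum>j. w j * \<theta> j * \<xi> j \<omega>)
      + (s\<^sup>2 * (\<Sum>j. w j * ((\<xi> j \<omega>)\<^sup>2 - 1)) + s\<^sup>2 * suminf w))"
    by (intro sums_add sums_mult summable_sums sq cross chi w)
  then have "(\<lambda>j. w j * (\<theta> j + s * \<xi> j \<omega>)\<^sup>2)
    sums ((\<Sum>j. w j * (\<theta> j)\<^sup>2) + 2 * s * (\<Sum>j. w j * \<theta> j * \<xi> j \<omega>)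
      + (s\<^sup>2 * (\<Sum>j. w j * ((\<xi> j \<omega>)\<^sup>2 - 1)) + s\<^sup>2 * suminf w))"
    by (rule sums_cong[THEN iffD1, rotated]) (simp add: power2_eq_square algebra_simps)
  then have total: "(\<Sum>j. w j * (\<theta> j + s * \<xi> j \<omega>)\<^sup>2) = (\<Sum>j. w j * (\<theta> j)\<^sup>2) + 2 * s * (\<Sum>j. w j * \<theta> j * \<xi> j \<omega>)
      + (s\<^sup>2 * (\<Sum>j. w j * ((\<xi> j \<omega>)\<^sup>2 - 1)) + s\<^sup>2 * suminf w)"
    by (simp add: sums_iff)
  have "(\<Sum>j. w j / v * ((\<xi> j \<omega>)\<^sup>2 - 1)) = (\<Sum>j. w j * ((\<xi> j \<omega>)\<^sup>2 - 1)) / v"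
    using suminf_divide[OF chi, of v] by simp
  moreover have lin: "(\<Sum>j. 2 / (s * v) * (w j * \<theta> j) * \<xi> j \<omega>) = 2 / (s * v) * (\<Sum>j. w j * \<theta> j * \<xi> j \<omega>)"
    using suminf_mult[OF cross, of "2 / (s * v)"] by (simp add: mult.assoc)
  moreover have "summable (\<lambda>j. 2 / (s * v) * (w j * \<theta> j) * \<xi> j \<omega>)"
    using summable_mult[OF cross, of "2 / (s * v)"] by (simp add: mult.assoc)
  ultimately show ?case
    unfolding total using nz by (simp add: power2_eq_square field_simps)
qed

lemma vanishing_relative_error_iff:
  fixes t :: "nat \<Rightarrow> real"
  assumes "0 < \<alpha>"
  shows "(\<exists>\<epsilon>. \<epsilon> \<longlonglongrightarrow> 0 \<and> (\<forall>n\<ge>1. t n = \<alpha> * (1 + \<epsilon> n))) \<longleftrightarrow> t \<longlonglongrightarrow> \<alpha>"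
proof
  assume "\<exists>\<epsilon>. \<epsilon> \<longlonglongrightarrow> 0 \<and> (\<forall>n\<ge>1. t n = \<alpha> * (1 + \<epsilon> n))"
  then obtain \<epsilon> where \<epsilon>: "\<epsilon> \<longlonglongrightarrow> 0" "\<And>n. n \<ge> 1 \<Longrightarrow> t n = \<alpha> * (1 + \<epsilon> n)" by blast
  have "(\<lambda>n. \<alpha> * (1 + \<epsilon> n)) \<longlonglongrightarrow> \<alpha> * (1 + 0)"
    by (intro tendsto_intros \<epsilon>)
  moreover have "\<forall>\<^sub>F n in sequentially. \<alpha> * (1 + \<epsilon> n) = t n"
    by (rule eventually_sequentiallyI[of 1]) (simp only: \<epsilon>(2))
  ultimately show "t \<longlonglongrightarrow> \<alpha>"
    using Lim_transform_eventually by fastforce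
next
  assume "t \<longlonglongrightarrow> \<alpha>"
  then have "(\<lambda>n. t n / \<alpha> - 1) \<longlonglongrightarrow> \<alpha> / \<alpha> - 1"
    using assms by (intro tendsto_intros) auto
  then show "\<exists>\<epsilon>. \<epsilon> \<longlonglongrightarrow> 0 \<and> (\<forall>n\<ge>1. t n = \<alpha> * (1 + \<epsilon> n))"
    using assms by (intro exI[of _ "\<lambda>n. t n / \<alpha> - 1"]) (auto simp: field_simps)
qed

theorem theorem4p1:
  fixes M :: "'a measure" and W :: "(real \<Rightarrow> real) \<Rightarrow> 'a \<Rightarrow> real"
    and \<phi> :: "nat \<Rightarrow> real \<Rightarrow> real" and \<kappa> :: "nat \<Rightarrow> nat \<Rightarrow> real"
    and f :: "nat \<Rightarrow> real \<Rightarrow> real" and r \<sigma> c C :: real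
  assumes "0 < r" "r < 1/2" and "\<sigma> > 0"
    and "white_noise M W"
    and "orthonormal_basis \<phi>"
    and "A1 \<kappa>" "A2 \<sigma> \<kappa>" "A3 r \<kappa>" "A4 \<kappa>" "A5 \<kappa>"
    and "\<And>n. n \<ge> 1 \<Longrightarrow> f n \<in> L2_01"
    and "0 < c" "c < C"
    and "\<And>n. n \<ge> 1 \<Longrightarrow> c * real n powr (- r) \<le> L2_norm (f n)"
    and "\<And>n. n \<ge> 1 \<Longrightarrow> L2_norm (f n) \<le> C * real n powr (- r)"
  shows "consistent_seq M \<sigma> W \<phi> \<kappa> f \<longleftrightarrow>
    (\<exists>c1>0. \<exists>c2>0. \<exists>n0. \<forall>n>n0.
       (\<Sum>j | 1 \<le> j \<and> real j < c2 * real (k_idx \<kappa> n). (L2_inner (f n) (\<phi> j))\<^sup>2)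
         > c1 * real n powr (- 2 * r))"
proof -
  have orth: "orthonormal_on {1..} \<phi>"
    using \<open>orthonormal_basis \<phi>\<close> by (simp add: orthonormal_basis_def)
  define \<xi> where "\<xi> j = W (\<phi> (Suc j))" for j
  have "orthonormal_on UNIV (\<lambda>j. \<phi> (Suc j))"
    using orth by (auto simp: orthonormal_on_def)
  then have "prob_space M" "prob_space.indep_vars M (\<lambda>_. borel) \<xi> UNIV"
    "\<forall>j\<in>UNIV. distributed M lborel (\<xi> j) std_normal_density"
    using \<open>white_noise M W\<close> unfolding white_noise_def \<xi>_def by blast+
  then interpret gaussian_sequence M \<xi>
    by (simp add: gaussian_sequence_def gaussian_sequence_axioms_def)

  define s where "s n = \<sigma> / sqrt (real n)" for n
  define w where "w n j = (\<kappa> n (Suc j))\<^sup>2" for n j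
  define S where "S n = (\<Sum>j. \<kappa> n (Suc j) ^ 4)" for n
  define v where "v n = sqrt (2 * S n)" for n
  define \<tau> where "\<tau> n = (s n)\<^sup>2 * v n" for n
  define \<theta> where "\<theta> n j = L2_inner (f n) (\<phi> j)" for n j
  define D where "D n = (\<Sum>j. w n j * (\<theta> n (Suc j))\<^sup>2)" for n
  define \<delta> where "\<delta> n = D n / \<tau> n" for n
  define Z where "Z n \<omega> = (\<Sum>j. w n j / v n * ((\<xi> j \<omega>)\<^sup>2 - 1))" for n \<omega>
  define b where "b n j = 2 / (s n * v n) * (w n j * \<theta> n (Suc j))" for n j
  define R where "R n \<omega> = (\<Sum>j. b n j * \<xi> j \<omega>)" for n \<omega>
  have [measurable]: "Z n \<in> borel_measurable M" "R n \<in> borel_measurable M" for n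
    unfolding Z_def R_def by measurable

  have mono: "(\<kappa> n j)\<^sup>2 \<le> (\<kappa> n i)\<^sup>2" if "1 \<le> n" "1 \<le> i" "i \<le> j" for n i j
    using \<open>A1 \<kappa>\<close> that unfolding A1_def by blast
  have sum_w: "summable (\<lambda>j. (\<kappa> n (Suc j))\<^sup>2)" and rho_pos: "0 < rho \<kappa> n" if "1 \<le> n" for n
    using \<open>A3 r \<kappa>\<close> that unfolding A3_def
    by (auto intro: less_le_trans[OF mult_pos_pos[of _ "real n powr (- 2 * r)"]])
  have sum_4: "summable (\<lambda>j. \<kappa> n (Suc j) ^ 4)" if "1 \<le> n" for n
    using summable_fourth_powers(1)[of \<kappa> n, OF sum_w[OF that]] mono[OF that, of 1] by simp
  have energy: "summable (\<lambda>j. (\<theta> n (Suc j))\<^sup>2)"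
    "(\<Sum>j. (\<theta> n (Suc j))\<^sup>2) \<le> C\<^sup>2 * real n powr (- 2 * r)" if "1 \<le> n" for n
  proof -
    show "summable (\<lambda>j. (\<theta> n (Suc j))\<^sup>2)"
      unfolding \<theta>_def using assms(11)[OF that] by (rule bessel_inequality[OF orth])
    have "(\<Sum>j. (\<theta> n (Suc j))\<^sup>2) \<le> (L2_norm (f n))\<^sup>2"
      unfolding \<theta>_def using assms(11)[OF that] by (rule bessel_inequality[OF orth])
    also have "\<dots> \<le> (C * real n powr (- r))\<^sup>2"
      using assms(15)[OF that]
      by (intro power_mono) (auto simp: L2_norm_def L2_inner_def intro!: integral_nonneg_AE)
    also have "\<dots> = C\<^sup>2 * real n powr (- 2 * r)"
      by (simp add: power_mult_distrib power2_eq_square mult.commute flip: powr_add)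
    finally show "(\<Sum>j. (\<theta> n (Suc j))\<^sup>2) \<le> C\<^sup>2 * real n powr (- 2 * r)" .
  qed
  obtain L U where LU: "0 < L" "0 < U" and orders:
    "\<forall>\<^sub>F n in sequentially. L * real n powr (2 * r - 2) \<le> kappa_sq \<kappa> n
       \<and> (\<kappa> n 1)\<^sup>2 \<le> U * real n powr (2 * r - 2)
       \<and> L / (real n)\<^sup>2 \<le> S n \<and> S n \<le> U / (real n)\<^sup>2"
    using coefficient_orders[OF \<open>\<sigma> > 0\<close> \<open>A1 \<kappa>\<close> \<open>A2 \<sigma> \<kappa>\<close> \<open>A3 r \<kappa>\<close> \<open>A5 \<kappa>\<close>] unfolding S_def by blast
  have scale: "\<forall>\<^sub>F n in sequentially. 1 \<le> n \<and> 0 < S n \<and> (\<forall>j. w n j \<le> U * real n powr (2 * r - 2))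
     \<and> L / (real n)\<^sup>2 \<le> S n \<and> S n \<le> U / (real n)\<^sup>2"
    using orders eventually_ge_at_top[of 1]
  proof eventually_elim
    case (elim n)
    have "0 < L / (real n)\<^sup>2" using LU elim by simp
    then show ?case
      using elim mono[OF elim(2), of 1] by (auto simp: w_def intro: order_trans)
  qed
  have rate: "(\<lambda>n. K * real n powr (2 * r - 1)) \<longlonglongrightarrow> 0" for K
    using tendsto_mult_right_zero[OF tendsto_neg_powr[OF _ filterlim_real_sequentially, of "2 * r - 1"], of K]
      \<open>r < 1/2\<close> by simp
  have rate_eq: "real n * real n powr (2 * r - 2) = real n powr (2 * r - 1)"
    "(real n)\<^sup>2 * real n powr (2 * r - 2) * real n powr (- 2 * r) = 1" if "1 \<le> n" for n
  proof -
    show "real n * real n powr (2 * r - 2) = real n powr (2 * r - 1)"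
      using that powr_mult_base[of "real n" "2 * r - 2"] by simp
    show "(real n)\<^sup>2 * real n powr (2 * r - 2) * real n powr (- 2 * r) = 1"
      using that by (simp add: powr_diff powr_minus powr_numeral)
  qed

  \<comment> \<open>the largest weight is at most a constant times \<open>n powr (2 * r - 2) / (1 / n)\<close>\<close>
  have normal: "weak_conv_m (\<lambda>n. distr M borel (Z n)) std_normal_distribution"
    unfolding Z_def[abs_def]
  proof (rule weighted_chi_square_clt[OF _ rate[of "U / sqrt (2 * L)"]])
    show "\<forall>\<^sub>F n in sequentially. (\<forall>j. 0 \<le> w n j / v n \<and> w n j / v n \<le> U / sqrt (2 * L) * real n powr (2 * r - 1))
      \<and> summable (\<lambda>j. w n j / v n) \<and> (\<lambda>j. (w n j / v n)\<^sup>2) sums (1 / 2)"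
      using scale
    proof eventually_elim
      case (elim n)
      then have n: "1 \<le> n" and v: "0 < v n" by (auto simp: v_def)
      have v_low: "sqrt (2 * L) / real n \<le> v n"
      proof -
        have "sqrt (2 * L) / real n = sqrt (2 * (L / (real n)\<^sup>2))"
          by (simp add: real_sqrt_divide)
        also have "\<dots> \<le> v n" using elim by (simp add: v_def del: times_divide_eq_right)
        finally show ?thesis .
      qed
      have "w n j / v n \<le> U / sqrt (2 * L) * real n powr (2 * r - 1)" for j
      proof -
        have "w n j / v n \<le> U * real n powr (2 * r - 2) / (sqrt (2 * L) / real n)"
          using elim v_low LU n by (intro frac_le) auto
        also have "\<dots> = U / sqrt (2 * L) * real n powr (2 * r - 1)"
          unfolding rate_eq(1)[OF n, symmetric] by simp
        finally show ?thesis .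
      qed
      moreover have "(\<lambda>j. (w n j / v n)\<^sup>2) sums (1 / 2)"
      proof -
        have "(\<lambda>j. \<kappa> n (Suc j) ^ 4 / (2 * S n)) sums (S n / (2 * S n))"
          unfolding S_def by (intro sums_divide summable_sums sum_4 n)
        moreover have "(w n j / v n)\<^sup>2 = \<kappa> n (Suc j) ^ 4 / (2 * S n)" for j
          using elim by (simp add: w_def v_def power_divide flip: power_mult)
        ultimately show ?thesis using elim by simp
      qed
      ultimately show ?case
        using v sum_w[OF n] by (auto simp: w_def intro: summable_divide)
    qed
  qed

  have statistic: "\<forall>\<^sub>F n in sequentially. 0 < \<tau> n \<and>
     (AE \<omega> in M. summable (\<lambda>j. b n j * \<xi> j \<omega>)) \<and>
     (AE \<omega> in M. T_stat \<sigma> W \<phi> \<kappa> n (\<lambda>_. 0) \<omega> = \<tau> n * Z n \<omega>) \<and>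
     (AE \<omega> in M. T_stat \<sigma> W \<phi> \<kappa> n (f n) \<omega> = \<tau> n * (Z n \<omega> + \<delta> n + R n \<omega>))"
    using scale
  proof eventually_elim
    case (elim n)
    then have n: "1 \<le> n" and v: "0 < v n" by (auto simp: v_def)
    have s: "0 < s n" "(s n)\<^sup>2 = \<sigma>\<^sup>2 / real n"
      using n \<open>\<sigma> > 0\<close> by (auto simp: s_def power_divide)
    have T: "T_stat \<sigma> W \<phi> \<kappa> n g \<omega> = (\<Sum>j. w n j * (L2_inner g (\<phi> (Suc j)) + s n * \<xi> j \<omega>)\<^sup>2) - (s n)\<^sup>2 * suminf (w n)" for g \<omega>
      unfolding T_stat_def obs_def rho_def s(2)[symmetric] s_def[symmetric] \<xi>_def[symmetric] w_def[abs_def] ..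
    have w: "\<And>j. 0 \<le> w n j" "summable (w n)"
      using sum_w[OF n] by (auto simp: w_def[abs_def])
    have "0 < \<tau> n" using s(1) v by (simp add: \<tau>_def)
    moreover note quadratic_statistic_decomposition[OF w energy(1)[OF n], of "s n" "v n"]
    moreover note quadratic_statistic_decomposition[OF w, of "\<lambda>_. 0" "s n" "v n"]
    ultimately show ?case
      using s(1) v unfolding T
      by (simp add: Z_def R_def \<delta>_def D_def \<tau>_def b_def \<theta>_def L2_inner_def[of "\<lambda>_. 0"])
  qed

  \<comment> \<open>the variance of \<open>R n\<close> is at most a constant times \<open>n ^ 3 * (\<kappa> n 1) ^ 4 * \<parallel>f n\<parallel>\<^sup>2\<close>,
    hence at most of order \<open>n powr (2 * r - 1)\<close>\<close>
  have negligible: "(\<lambda>n. prob {\<omega> \<in> space M. e \<le> \<bar>R n \<omega>\<bar>}) \<longlonglongrightarrow> 0" if "0 < e" for e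
  proof (rule tendsto_sandwich[OF _ _ tendsto_const rate])
    show "\<forall>\<^sub>F n in sequentially. prob {\<omega> \<in> space M. e \<le> \<bar>R n \<omega>\<bar>}
        \<le> 2 * U\<^sup>2 * C\<^sup>2 / (\<sigma>\<^sup>2 * L * e\<^sup>2) * real n powr (2 * r - 1)"
      using scale statistic
    proof eventually_elim
      case (elim n)
      then have n: "1 \<le> n" and S: "0 < S n" by auto
      let ?g = "real n powr (2 * r - 2)"
      have sv: "(s n * v n)\<^sup>2 = 2 * \<sigma>\<^sup>2 / real n * S n"
        using S by (simp add: s_def v_def power_mult_distrib power_divide)
      have sv_pos: "0 < 2 * \<sigma>\<^sup>2 / real n * (L / (real n)\<^sup>2)"
        using n LU \<open>\<sigma> > 0\<close> by simp
      have b_le: "(b n j)\<^sup>2 \<le> 4 / (2 * \<sigma>\<^sup>2 / real n * (L / (real n)\<^sup>2)) * (U * ?g)\<^sup>2 * (\<theta> n (Suc j))\<^sup>2" for j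
      proof -
        have "(b n j)\<^sup>2 = 4 / (2 * \<sigma>\<^sup>2 / real n * S n) * (w n j)\<^sup>2 * (\<theta> n (Suc j))\<^sup>2"
          unfolding b_def power_mult_distrib power_divide sv[unfolded power_mult_distrib] by simp
        also have "\<dots> \<le> 4 / (2 * \<sigma>\<^sup>2 / real n * (L / (real n)\<^sup>2)) * (U * ?g)\<^sup>2 * (\<theta> n (Suc j))\<^sup>2"
        proof (intro mult_right_mono mult_mono divide_left_mono mult_left_mono power_mono)
          show "0 < 2 * \<sigma>\<^sup>2 / real n * S n * (2 * \<sigma>\<^sup>2 / real n * (L / (real n)\<^sup>2))"
            using LU S n \<open>\<sigma> > 0\<close> by (intro mult_pos_pos) auto
        qed (use elim sv_pos LU in \<open>auto simp: w_def intro: less_imp_le\<close>)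
        finally show ?thesis .
      qed
      let ?q = "4 / (2 * \<sigma>\<^sup>2 / real n * (L / (real n)\<^sup>2)) * (U * ?g)\<^sup>2"
      have b_sum: "summable (\<lambda>j. (b n j)\<^sup>2)"
        by (rule summable_comparison_test'[OF summable_mult[OF energy(1)[OF n], of ?q]]) (use b_le in auto)
      have "prob {\<omega> \<in> space M. e \<le> \<bar>R n \<omega>\<bar>} \<le> (\<Sum>j. (b n j)\<^sup>2) / e\<^sup>2"
        unfolding R_def using elim b_sum that by (intro linear_series_deviation_bound) auto
      also have "\<dots> \<le> (?q * (C\<^sup>2 * real n powr (- 2 * r))) / e\<^sup>2"
      proof (rule divide_right_mono)
        have "(\<Sum>j. (b n j)\<^sup>2) \<le> (\<Sum>j. ?q * (\<theta> n (Suc j))\<^sup>2)"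
          by (intro suminf_le b_le b_sum summable_mult energy n)
        also have "\<dots> = ?q * (\<Sum>j. (\<theta> n (Suc j))\<^sup>2)"
          by (rule suminf_mult[OF energy(1)[OF n]])
        also have "\<dots> \<le> ?q * (C\<^sup>2 * real n powr (- 2 * r))"
          using energy(2)[OF n] LU by (intro mult_left_mono) auto
        finally show "(\<Sum>j. (b n j)\<^sup>2) \<le> ?q * (C\<^sup>2 * real n powr (- 2 * r))" .
      qed simp
      also have "\<dots> = 2 * U\<^sup>2 * C\<^sup>2 / (\<sigma>\<^sup>2 * L * e\<^sup>2) * (real n * ?g * ((real n)\<^sup>2 * ?g * real n powr (- 2 * r)))"
        by (simp add: power2_eq_square mult_ac)
      also have "\<dots> = 2 * U\<^sup>2 * C\<^sup>2 / (\<sigma>\<^sup>2 * L * e\<^sup>2) * real n powr (2 * r - 1)"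
        unfolding rate_eq[OF n] by simp
      finally show ?case .
    qed
  qed auto

  have errors: "\<forall>\<^sub>F n in sequentially. 0 < \<tau> n \<and> (\<forall>x.
      type1_error M \<sigma> W \<phi> \<kappa> n x = prob {\<omega> \<in> space M. x / \<tau> n < Z n \<omega>} \<and>
      type2_error M \<sigma> W \<phi> \<kappa> n x (f n) = prob {\<omega> \<in> space M. Z n \<omega> + \<delta> n + R n \<omega> \<le> x / \<tau> n})"
    using statistic
  proof eventually_elim
    case (elim n)
    then have \<tau>: "0 < \<tau> n"
      and T0: "AE \<omega> in M. T_stat \<sigma> W \<phi> \<kappa> n (\<lambda>_. 0) \<omega> = \<tau> n * Z n \<omega>"
      and Tf: "AE \<omega> in M. T_stat \<sigma> W \<phi> \<kappa> n (f n) \<omega> = \<tau> n * (Z n \<omega> + \<delta> n + R n \<omega>)"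
      by auto
    have [measurable]: "T_stat \<sigma> W \<phi> \<kappa> n g \<in> borel_measurable M" for g
      unfolding T_stat_def[abs_def] obs_def \<xi>_def[symmetric] by measurable
    have "type1_error M \<sigma> W \<phi> \<kappa> n x = prob {\<omega> \<in> space M. x / \<tau> n < Z n \<omega>}" for x
      unfolding type1_error_def
    proof (rule finite_measure_eq_AE)
      show "AE \<omega> in M. (\<omega> \<in> {\<omega> \<in> space M. x < T_stat \<sigma> W \<phi> \<kappa> n (\<lambda>_. 0) \<omega>}) = (\<omega> \<in> {\<omega> \<in> space M. x / \<tau> n < Z n \<omega>})"
        using T0 by eventually_elim (use \<tau> in \<open>simp add: pos_divide_less_eq mult.commute\<close>)
    qed measurable
    moreover have "type2_error M \<sigma> W \<phi> \<kappa> n x (f n) = prob {\<omega> \<in> space M. Z n \<omega> + \<delta> n + R n \<omega> \<le> x / \<tau> n}" for x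
      unfolding type2_error_def
    proof (rule finite_measure_eq_AE)
      show "AE \<omega> in M. (\<omega> \<in> {\<omega> \<in> space M. \<not> x < T_stat \<sigma> W \<phi> \<kappa> n (f n) \<omega>})
          = (\<omega> \<in> {\<omega> \<in> space M. Z n \<omega> + \<delta> n + R n \<omega> \<le> x / \<tau> n})"
        using Tf by eventually_elim (use \<tau> in \<open>simp add: pos_le_divide_eq not_less mult.commute\<close>)
    qed measurable
    ultimately show ?case using elim by blast
  qed

  let ?level = "\<lambda>\<alpha> y. (\<lambda>n. prob {\<omega> \<in> space M. y n < Z n \<omega>}) \<longlonglongrightarrow> \<alpha>"
  let ?power = "\<lambda>\<alpha> y. limsup (\<lambda>n. ereal (prob {\<omega> \<in> space M. Z n \<omega> + \<delta> n + R n \<omega> \<le> y n})) < ereal (1 - \<alpha>)"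
  \<comment> \<open>thresholds \<open>x n\<close> for the statistic correspond to thresholds \<open>x n / \<tau> n\<close> for its standardised form\<close>
  have rescale: "(\<lambda>n. type1_error M \<sigma> W \<phi> \<kappa> n (x n)) \<longlonglongrightarrow> \<alpha> \<longleftrightarrow> ?level \<alpha> y"
      "limsup (\<lambda>n. ereal (type2_error M \<sigma> W \<phi> \<kappa> n (x n) (f n))) < ereal (1 - \<alpha>) \<longleftrightarrow> ?power \<alpha> y"
    if "\<forall>\<^sub>F n in sequentially. x n / \<tau> n = y n" for x y \<alpha>
  proof -
    have "\<forall>\<^sub>F n in sequentially. type1_error M \<sigma> W \<phi> \<kappa> n (x n) = prob {\<omega> \<in> space M. y n < Z n \<omega>}"
      using errors that by eventually_elim auto
    then show "(\<lambda>n. type1_error M \<sigma> W \<phi> \<kappa> n (x n)) \<longlonglongrightarrow> \<alpha> \<longleftrightarrow> ?level \<alpha> y"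
      by (rule tendsto_cong)
    have "limsup (\<lambda>n. ereal (type2_error M \<sigma> W \<phi> \<kappa> n (x n) (f n)))
        = limsup (\<lambda>n. ereal (prob {\<omega> \<in> space M. Z n \<omega> + \<delta> n + R n \<omega> \<le> y n}))"
      by (rule Limsup_eq) (use errors that in eventually_elim, auto)
    then show "limsup (\<lambda>n. ereal (type2_error M \<sigma> W \<phi> \<kappa> n (x n) (f n))) < ereal (1 - \<alpha>) \<longleftrightarrow> ?power \<alpha> y"
      by simp
  qed
  have "consistent_seq M \<sigma> W \<phi> \<kappa> f \<longleftrightarrow>
      (\<forall>\<alpha>. 0 < \<alpha> \<and> \<alpha> < 1 \<longrightarrow> (\<forall>x. (\<lambda>n. type1_error M \<sigma> W \<phi> \<kappa> n (x n)) \<longlonglongrightarrow> \<alpha> \<longrightarrow>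
        limsup (\<lambda>n. ereal (type2_error M \<sigma> W \<phi> \<kappa> n (x n) (f n))) < ereal (1 - \<alpha>)))"
    unfolding consistent_seq_def
    by (intro iff_allI imp_cong refl vanishing_relative_error_iff) simp
  also have "\<dots> \<longleftrightarrow> (\<forall>\<alpha>. 0 < \<alpha> \<and> \<alpha> < 1 \<longrightarrow> (\<forall>y. ?level \<alpha> y \<longrightarrow> ?power \<alpha> y))"
  proof (rule iff_allI, rule imp_cong[OF refl], intro iffI allI impI)
    fix \<alpha> and y :: "nat \<Rightarrow> real"
    assume x: "\<forall>x. (\<lambda>n. type1_error M \<sigma> W \<phi> \<kappa> n (x n)) \<longlonglongrightarrow> \<alpha> \<longrightarrow>
        limsup (\<lambda>n. ereal (type2_error M \<sigma> W \<phi> \<kappa> n (x n) (f n))) < ereal (1 - \<alpha>)" and y: "?level \<alpha> y"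
    have eq: "\<forall>\<^sub>F n in sequentially. y n * \<tau> n / \<tau> n = y n"
      using errors by eventually_elim simp
    show "?power \<alpha> y"
      using x[THEN spec, of "\<lambda>n. y n * \<tau> n"] y unfolding rescale[OF eq] by (rule mp)
  next
    fix \<alpha> and x :: "nat \<Rightarrow> real"
    assume y: "\<forall>y. ?level \<alpha> y \<longrightarrow> ?power \<alpha> y" and x: "(\<lambda>n. type1_error M \<sigma> W \<phi> \<kappa> n (x n)) \<longlonglongrightarrow> \<alpha>"
    show "limsup (\<lambda>n. ereal (type2_error M \<sigma> W \<phi> \<kappa> n (x n) (f n))) < ereal (1 - \<alpha>)"
      using y[THEN spec, of "\<lambda>n. x n / \<tau> n"] x unfolding rescale[of x "\<lambda>n. x n / \<tau> n", simplified] by (rule mp)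
  qed
  also have "\<dots> \<longleftrightarrow> (\<exists>d>0. \<forall>\<^sub>F n in sequentially. d \<le> \<delta> n)"
    by (rule asymptotically_normal_shift_detectable_iff[OF _ _ normal negligible]) measurable
  also have "\<dots> \<longleftrightarrow> (\<exists>d>0. \<forall>\<^sub>F n in sequentially. d \<le> (real n)\<^sup>2 * D n)"
  proof -
    \<comment> \<open>\<open>\<tau> n\<close> has exact order \<open>1 / n\<^sup>2\<close>, since \<open>S n\<close> does\<close>
    have \<tau>_le: "\<forall>\<^sub>F n in sequentially. 0 < \<tau> n \<and> \<sigma>\<^sup>2 * sqrt (2 * L) \<le> (real n)\<^sup>2 * \<tau> n \<and> (real n)\<^sup>2 * \<tau> n \<le> \<sigma>\<^sup>2 * sqrt (2 * U)"
      using scale errors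
    proof eventually_elim
      case (elim n)
      then have n: "1 \<le> n" by simp
      have "(real n)\<^sup>2 * \<tau> n = \<sigma>\<^sup>2 * (real n * v n)"
        using n by (simp add: \<tau>_def s_def power_divide power2_eq_square)
      also have "real n * v n = sqrt (2 * ((real n)\<^sup>2 * S n))"
        by (simp add: v_def real_sqrt_mult)
      finally have eq: "(real n)\<^sup>2 * \<tau> n = \<sigma>\<^sup>2 * sqrt (2 * ((real n)\<^sup>2 * S n))" .
      have "L \<le> (real n)\<^sup>2 * S n" "(real n)\<^sup>2 * S n \<le> U"
        using elim n by (auto simp: field_simps)
      then show ?case
        unfolding eq using elim by (auto intro!: mult_left_mono)
    qed
    show ?thesis
    proof (intro iffI; elim exE conjE)
      fix d :: real assume d: "0 < d" "\<forall>\<^sub>F n in sequentially. d \<le> \<delta> n"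
      have "\<forall>\<^sub>F n in sequentially. d * (\<sigma>\<^sup>2 * sqrt (2 * L)) \<le> (real n)\<^sup>2 * D n"
        using d(2) \<tau>_le
      proof eventually_elim
        case (elim n)
        have "d * (\<sigma>\<^sup>2 * sqrt (2 * L)) \<le> d * ((real n)\<^sup>2 * \<tau> n)"
          using d elim by (intro mult_left_mono) auto
        also have "\<dots> = (real n)\<^sup>2 * (d * \<tau> n)" by simp
        also have "\<dots> \<le> (real n)\<^sup>2 * D n"
          using elim by (intro mult_left_mono) (auto simp: \<delta>_def field_simps)
        finally show ?case .
      qed
      moreover have "0 < d * (\<sigma>\<^sup>2 * sqrt (2 * L))" using d LU \<open>\<sigma> > 0\<close> by simp
      ultimately show "\<exists>d>0. \<forall>\<^sub>F n in sequentially. d \<le> (real n)\<^sup>2 * D n" by blast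
    next
      fix d :: real assume d: "0 < d" "\<forall>\<^sub>F n in sequentially. d \<le> (real n)\<^sup>2 * D n"
      have "\<forall>\<^sub>F n in sequentially. d / (\<sigma>\<^sup>2 * sqrt (2 * U)) \<le> \<delta> n"
        using d(2) \<tau>_le eventually_gt_at_top[of 0]
      proof eventually_elim
        case (elim n)
        have "d / (\<sigma>\<^sup>2 * sqrt (2 * U)) \<le> (real n)\<^sup>2 * D n / ((real n)\<^sup>2 * \<tau> n)"
          using d elim by (intro frac_le) auto
        then show ?case using elim by (simp add: \<delta>_def)
      qed
      moreover have "0 < d / (\<sigma>\<^sup>2 * sqrt (2 * U))" using d LU \<open>\<sigma> > 0\<close> by simp
      ultimately show "\<exists>d>0. \<forall>\<^sub>F n in sequentially. d \<le> \<delta> n" by blast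
    qed
  qed
  also have "\<dots> \<longleftrightarrow> (\<exists>c1>0. \<exists>c2>0. \<exists>n0. \<forall>n>n0.
       (\<Sum>j | 1 \<le> j \<and> real j < c2 * real (k_idx \<kappa> n). (\<theta> n j)\<^sup>2) > c1 * real n powr (- 2 * r))"
    unfolding D_def w_def
  proof (rule weighted_sum_separated_iff[OF \<open>A1 \<kappa>\<close> \<open>A4 \<kappa>\<close> \<open>A5 \<kappa>\<close> LU _ _ _ energy])
    show "1 \<le> k_idx \<kappa> n" if "1 \<le> n" for n
      by (rule k_idx_half_sum[OF sum_w rho_pos]) (use that in auto)
    show "\<forall>\<^sub>F n in sequentially. L * real n powr (2 * r - 2) \<le> kappa_sq \<kappa> n \<and> (\<kappa> n 1)\<^sup>2 \<le> U * real n powr (2 * r - 2)"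
      using orders by eventually_elim simp
  qed auto
  finally show ?thesis
    unfolding \<theta>_def .
qed

end
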